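(* Let $p>2$ and $q>1$, and let $B_{p,q}:[0,\frac1{p-1}]\to[0,\frac1{q-1}]$ be the continuous function that coincides with the base-change function $b_{p,q}$ on $J_p$ and is affine on each connected component of $[0,\frac1{p-1}]\setminus J_p$. (i) The function $B_{p,q}$ is differentiable almost everywhere, and is Hölder continuous with the exact exponent $\min\left\{1,\frac{\log q}{\log p}\right\}$. (ii) If $q<2$, then $B_{p,q}$ does not have bounded variation. (iii) If $q=2$, then $B_{p,q}$ is non-decreasing, but not absolutely continuous. Its arc length is equal to $\frac{p}{p-1}$. (iv) If $q>2$, then $B_{p,q}$ is (strictly) increasing, absolutely continuous, and $B_{p,q}'>0$ almost everywhere.
   Context: For a real base $r>1$ and $c=(c_i)_{i\ge1}\in\{0,1\}^\infty$ put $\pi_r(c):=\sum_{i=1}^\infty c_i r^{-i}$ and $J_r:=\pi_r(\{0,1\}^\infty)$. For $p>2$ each $x\in J_p$ has a unique sequence $b_p(x)=(b_i)\in\{0,1\}^\infty$ with $\pi_p(b_p(x))=x$, and the base-change function is $b_{p,q}:=\pi_q\circ b_p:J_p\to J_q$, i.e. $b_{p,q}(x)=\sum_{i\ge1}b_iq^{-i}$. For $p>2$ the set $J_p$ is a closed subset of $[0,\frac1{p-1}]$ containing both endpoints, so $B_{p,q}$ is well defined. A function $f$ on an interval is Hölder continuous with exponent $\alpha>0$ if there is a constant $C$ with $|f(x)-f(y)|\le C|x-y|^\alpha$ for all $x,y$; the exponent is exact if it cannot be replaced by any larger one. The arc length of a function is the length of its graph (supremum of lengths of inscribed polygonal lines).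 "Almost everywhere" refers to Lebesgue measure. *)

theory Defs
  imports "HOL-Analysis.Analysis"
begin

text \<open>Sequences are 0-indexed: \<open>c i\<close> is the digit written \<open>c\<^sub>i\<^sub>+\<^sub>1\<close> in the
  1-indexed convention, so it carries the weight \<open>1 / r ^ (i + 1)\<close>.\<close>

definition digit_seqs :: "(nat \<Rightarrow> nat) set" where
  "digit_seqs = UNIV \<rightarrow> {0, 1}"

definition digit_val :: "real \<Rightarrow> (nat \<Rightarrow> nat) \<Rightarrow> real" where
  "digit_val r c = (\<Sum>i. real (c i) / r ^ Suc i)"

definition J_set :: "real \<Rightarrow> real set" where
  "J_set r = digit_val r ` digit_seqs"

definition digits :: "real \<Rightarrow> real \<Rightarrow> (nat \<Rightarrow> nat)" where
  "digits p x = (THE c. c \<in> digit_seqs \<and> digit_val p c = x)"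

definition base_change :: "real \<Rightarrow> real \<Rightarrow> real \<Rightarrow> real" where
  "base_change p q x = digit_val q (digits p x)"

definition affine_fun_on :: "real set \<Rightarrow> (real \<Rightarrow> real) \<Rightarrow> bool" where
  "affine_fun_on C f \<longleftrightarrow> (\<exists>m k. \<forall>x\<in>C. f x = m * x + k)"

text \<open>The function \<open>B\<^sub>p\<^sub>,\<^sub>q\<close>. Membership in the extensional function space makes the
  description unique as a total HOL function; outside the interval the value is
  \<open>undefined\<close> and irrelevant.\<close>

definition base_change_ext :: "real \<Rightarrow> real \<Rightarrow> real \<Rightarrow> real" where
  "base_change_ext p q = (THE B.
     B \<in> {0..1 / (p - 1)} \<rightarrow>\<^sub>E {0..1 / (q - 1)} \<and>
     continuous_on {0..1 / (p - 1)} B \<and>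
     (\<forall>x\<in>J_set p. B x = base_change p q x) \<and>
     (\<forall>C\<in>components ({0..1 / (p - 1)} - J_set p). affine_fun_on C B))"

definition holder_on :: "real set \<Rightarrow> real \<Rightarrow> (real \<Rightarrow> real) \<Rightarrow> bool" where
  "holder_on S \<alpha> f \<longleftrightarrow>
     \<alpha> > 0 \<and> (\<exists>C. \<forall>x\<in>S. \<forall>y\<in>S. \<bar>f x - f y\<bar> \<le> C * \<bar>x - y\<bar> powr \<alpha>)"

definition exact_holder_on :: "real set \<Rightarrow> real \<Rightarrow> (real \<Rightarrow> real) \<Rightarrow> bool" where
  "exact_holder_on S \<alpha> f \<longleftrightarrow> holder_on S \<alpha> f \<and> (\<forall>\<beta>>\<alpha>. \<not> holder_on S \<beta> f)"

text \<open>Finite increasing chains \<open>t 0 < \<dots> < t n\<close> of points of an interval \<open>S\<close>. They need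
  not include the endpoints of \<open>S\<close>; this does not change the suprema below, since adding
  points only increases the sums.\<close>

definition chain_in :: "real set \<Rightarrow> nat \<Rightarrow> (nat \<Rightarrow> real) \<Rightarrow> bool" where
  "chain_in S n t \<longleftrightarrow> (\<forall>i\<le>n. t i \<in> S) \<and> (\<forall>i<n. t i < t (Suc i))"

definition bounded_variation_on :: "real set \<Rightarrow> (real \<Rightarrow> real) \<Rightarrow> bool" where
  "bounded_variation_on S f \<longleftrightarrow>
     (\<exists>M. \<forall>n t. chain_in S n t \<longrightarrow> (\<Sum>i<n. \<bar>f (t (Suc i)) - f (t i)\<bar>) \<le> M)"

definition abs_continuous_on :: "real set \<Rightarrow> (real \<Rightarrow> real) \<Rightarrow> bool" where
  "abs_continuous_on S f \<longleftrightarrow>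
     (\<forall>\<epsilon>>0. \<exists>\<delta>>0. \<forall>(n::nat) u v.
        (\<forall>i<n. u i \<le> v i \<and> {u i..v i} \<subseteq> S) \<longrightarrow>
        disjoint_family_on (\<lambda>i. {u i<..<v i}) {..<n} \<longrightarrow>
        (\<Sum>i<n. v i - u i) < \<delta> \<longrightarrow>
        (\<Sum>i<n. \<bar>f (v i) - f (u i)\<bar>) < \<epsilon>)"

text \<open>Here \<open>dist\<close> is the Euclidean distance on the plane.\<close>

definition arc_length_on :: "real set \<Rightarrow> (real \<Rightarrow> real) \<Rightarrow> ereal" where
  "arc_length_on S f =
     (SUP (n, t) \<in> {(n, t). chain_in S n t}.
        ereal (\<Sum>i<n. dist (t i, f (t i)) (t (Suc i), f (t (Suc i)))))"

end

theory Submission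
  imports Defs
begin

text \<open>On \<open>J\<close>, two points whose digits first differ at index \<open>n\<close> are at distance of order
  \<open>p ^ -n\<close>, while their images are within order \<open>q ^ -n\<close>; Hoelder bounds with exponent at most 1 and
  (strict) monotonicity pass from a closed set to the gap-wise affine extension. Since \<open>J\<close> consists
  of two copies of itself scaled by \<open>1 / p\<close> and \<open>p > 2\<close>, it is a null set, and off \<open>J\<close> the function
  is locally affine. The \<open>2 ^ n\<close> intervals of level \<open>n\<close> have total length of order \<open>(2 / p) ^ n\<close>
  and carry total increment \<open>(2 / q) ^ n / (q - 1)\<close>. For \<open>q < 2\<close> this is unbounded; for \<open>q = 2\<close>
  it stays 1, which excludes absolute continuity and forces the maximal arc length; for \<open>q > 2\<close>
  it tends to 0, and removing these increments leaves a Lipschitz function, whence absolute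
  continuity.\<close>

section \<open>Gap-wise affine functions\<close>

text \<open>A bounded complementary interval of \<open>J\<close>, encoded by its endpoints so that
  values on \<open>J\<close> can be prescribed at both ends.\<close>

definition gap :: "real set \<Rightarrow> real \<Rightarrow> real \<Rightarrow> bool" where
  "gap J a b \<longleftrightarrow> a \<in> J \<and> b \<in> J \<and> a < b \<and> {a<..<b} \<inter> J = {}"

text \<open>The chord formula includes both endpoints of the gap. Values on \<open>J\<close>
  therefore fix the function on every gap, and no continuity assumption is needed to join the
  pieces.\<close>

definition gap_affine :: "real set \<Rightarrow> (real \<Rightarrow> real) \<Rightarrow> bool" where
  "gap_affine J f \<longleftrightarrow>
     (\<forall>a b x. gap J a b \<longrightarrow> a \<le> x \<longrightarrow> x \<le> b \<longrightarrow> f x = f a + (f b - f a) / (b - a) * (x - a))"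

lemma gap_affineD:
  "gap_affine J f \<Longrightarrow> gap J a b \<Longrightarrow> a \<le> x \<Longrightarrow> x \<le> b \<Longrightarrow>
     f x = f a + (f b - f a) / (b - a) * (x - a)"
  unfolding gap_affine_def by blast

lemma gap_affine_diff:
  assumes "gap_affine J f" "gap J a b" "a \<le> x" "x \<le> b" "a \<le> y" "y \<le> b"
  shows "f y - f x = (f b - f a) / (b - a) * (y - x)"
proof -
  have "f x = f a + (f b - f a) / (b - a) * (x - a)" "f y = f a + (f b - f a) / (b - a) * (y - a)"
    by (rule gap_affineD[OF assms(1,2)]; use assms in simp)+
  then show ?thesis by (simp only: algebra_simps)
qed

lemma gapD: "gap J a b \<Longrightarrow> z \<in> J \<Longrightarrow> z \<le> a \<or> b \<le> z"
  unfolding gap_def by force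

lemma gap_unique:
  assumes "gap J a b" "gap J a' b'" "a < x" "x < b" "a' < x" "x < b'"
  shows "a' = a \<and> b' = b"
proof -
  have "a \<in> J" "b \<in> J" "a' \<in> J" "b' \<in> J" using assms by (auto simp: gap_def)
  then show ?thesis
    using gapD[OF assms(1), of a'] gapD[OF assms(1), of b'] gapD[OF assms(2), of a]
      gapD[OF assms(2), of b] assms by linarith
qed

locale closed_hull =
  fixes J :: "real set" and u v :: real
  assumes closed_J: "closed J" and J_sub: "J \<subseteq> {u..v}" and u_in: "u \<in> J" and v_in: "v \<in> J"
begin

text \<open>Since \<open>J\<close> is closed, the nearest points of \<open>J\<close> on either side
  of \<open>x\<close> are attained; they exist because \<open>u\<close> and \<open>v\<close> lie in
  \<open>J\<close>.\<close>

lemma gap_containing: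
  assumes "x \<in> {u..v}" "x \<notin> J"
  obtains a b where "gap J a b" "a < x" "x < b"
proof -
  define A where "A = J \<inter> {..x}"
  define D where "D = J \<inter> {x..}"
  have A: "Sup A \<in> A"
    by (rule closed_contains_Sup)
      (use assms u_in closed_J in \<open>auto simp: A_def intro!: closed_Int bdd_aboveI[of _ x]\<close>)
  have D: "Inf D \<in> D"
    by (rule closed_contains_Inf)
      (use assms v_in closed_J in \<open>auto simp: D_def intro!: closed_Int bdd_belowI[of _ x]\<close>)
  have lt: "Sup A < x" "x < Inf D" using A D assms
    by (auto simp: A_def D_def less_le)
  have upper: "z \<le> Sup A" if "z \<in> J" "z \<le> x" for z
    using that by (intro cSup_upper) (auto simp: A_def intro!: bdd_aboveI[of _ x])
  have lower: "Inf D \<le> z" if "z \<in> J" "x \<le> z" for z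
    using that by (intro cInf_lower) (auto simp: D_def intro!: bdd_belowI[of _ x])
  have "z \<le> Sup A \<or> Inf D \<le> z" if "z \<in> J" for z
    using upper[OF that] lower[OF that] by linarith
  then have "gap J (Sup A) (Inf D)" using A D lt unfolding gap_def A_def D_def by fastforce
  then show ?thesis using lt that by blast
qed

text \<open>Reduces estimates on pairs of points to one gap, or to at most two gaps and two points
  of \<^term>\<open>J\<close>.\<close>

lemma point_pair_cases:
  assumes "x \<in> {u..v}" "y \<in> {u..v}" "x < y"
  obtains (same) a b where "gap J a b" "a \<le> x" "y \<le> b"
  | (sep) a b where "a \<in> J" "b \<in> J" "x \<le> a" "a \<le> b" "b \<le> y"
      "x = a \<or> (\<exists>a'. gap J a' a \<and> a' < x)" "y = b \<or> (\<exists>b'. gap J b b' \<and> y < b')"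
proof -
  have "\<exists>a\<in>J. x \<le> a \<and> (x = a \<or> (\<exists>a'. gap J a' a \<and> a' < x))"
  proof (cases "x \<in> J")
    case False
    with gap_containing[OF assms(1)] obtain a' a where "gap J a' a" "a' < x" "x < a" by blast
    then show ?thesis by (intro bexI[of _ a]) (auto simp: gap_def)
  qed auto
  then obtain a where a: "a \<in> J" "x \<le> a" "x = a \<or> (\<exists>a'. gap J a' a \<and> a' < x)" by blast
  have "\<exists>b\<in>J. b \<le> y \<and> (y = b \<or> (\<exists>b'. gap J b b' \<and> y < b'))"
  proof (cases "y \<in> J")
    case False
    with gap_containing[OF assms(2)] obtain b b' where "gap J b b'" "b < y" "y < b'" by blast
    then show ?thesis by (intro bexI[of _ b]) (auto simp: gap_def)
  qed auto
  then obtain b where b: "b \<in> J" "b \<le> y" "y = b \<or> (\<exists>b'. gap J b b' \<and> y < b')" by blast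
  show ?thesis
  proof (cases "a \<le> b")
    case True
    then show ?thesis using sep a b by blast
  next
    case False
    from b(3) have "y \<le> a" 
    proof
      assume "\<exists>b'. gap J b b' \<and> y < b'"
      then show ?thesis using gapD a(1) False by fastforce
    qed (use False in auto)
    with a(3) \<open>x < y\<close> obtain a' where "gap J a' a" "a' < x" by auto
    then show ?thesis using same \<open>y \<le> a\<close> by force
  qed
qed

section \<open>Transfer of order and Hoelder estimates from a closed set to its hull\<close>

lemma mono_on_hull:
  assumes f: "gap_affine J f" "mono_on J f"
  shows "mono_on {u..v} f"
proof (rule mono_onI)
  have gap_mono: "f x \<le> f y" if "gap J a b" "a \<le> x" "x \<le> y" "y \<le> b" for a b x y
  proof -
    have "f a \<le> f b" using f(2) that(1) by (auto simp: gap_def mono_on_def)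
    then have "0 \<le> f y - f x"
      using that by (subst gap_affine_diff[OF f(1) that(1)]) auto
    then show ?thesis by simp
  qed
  fix x y assume xy: "x \<in> {u..v}" "y \<in> {u..v}" "x \<le> y"
  show "f x \<le> f y"
  proof (cases "x = y")
    case False
    with xy have "x < y" by simp
    from xy(1,2) this show ?thesis
    proof (cases rule: point_pair_cases)
      case (same a b)
      then show ?thesis using gap_mono xy by blast
    next
      case (sep a b)
      have "f x \<le> f a" using sep gap_mono by force
      moreover have "f a \<le> f b" using sep f(2) by (auto simp: mono_on_def)
      moreover have "f b \<le> f y" using sep gap_mono by force
      ultimately show ?thesis by simp
    qed
  qed simp
qed

lemma strict_mono_on_hull:
  assumes f: "gap_affine J f" "strict_mono_on J f"
  shows "strict_mono_on {u..v} f"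
proof (rule strict_mono_onI)
  have gap_mono: "f x < f y" if "gap J a b" "a \<le> x" "x < y" "y \<le> b" for a b x y
  proof -
    have "f a < f b" using f(2) that(1) by (auto simp: gap_def strict_mono_on_def)
    then have "0 < f y - f x"
      using that by (subst gap_affine_diff[OF f(1) that(1)]) auto
    then show ?thesis by simp
  qed
  fix x y assume xy: "x \<in> {u..v}" "y \<in> {u..v}" "x < y"
  then show "f x < f y"
  proof (cases rule: point_pair_cases)
    case (same a b)
    then show ?thesis using gap_mono xy by blast
  next
    case (sep a b)
    have "f x < f a \<or> x = a" using sep gap_mono by force
    moreover have "f a < f b \<or> a = b" using sep f(2) by (auto simp: strict_mono_on_def)
    moreover have "f b < f y \<or> b = y" using sep gap_mono by force
    ultimately show ?thesis using xy by auto
  qed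
qed

text \<open>A pair of points splits into at most two pieces inside gaps and one pair in
  \<open>J\<close>. Each piece obeys the bound with the same constant, whence the factor 3.\<close>

lemma holder_on_hull:
  assumes f: "gap_affine J f" "holder_on J \<alpha> f" and \<alpha>: "\<alpha> \<le> 1"
  shows "holder_on {u..v} \<alpha> f"
proof -
  obtain C0 where \<alpha>0: "0 < \<alpha>" and C0: "\<forall>x\<in>J. \<forall>y\<in>J. \<bar>f x - f y\<bar> \<le> C0 * \<bar>x - y\<bar> powr \<alpha>"
    using f(2) unfolding holder_on_def by blast
  \<comment> \<open>The given constant may be negative, for instance when \<open>J\<close> is a
    single point; the monotonicity steps below need a nonnegative one.\<close>
  define C where "C = \<bar>C0\<bar>"
  have C: "\<bar>f x - f y\<bar> \<le> C * \<bar>x - y\<bar> powr \<alpha>" if "x \<in> J" "y \<in> J" for x y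
    unfolding C_def using C0 that by (meson abs_ge_self mult_right_mono order_trans powr_ge_zero)
  have Cnn: "0 \<le> C" by (simp add: C_def)
  have gap_bound: "\<bar>f y - f x\<bar> \<le> C * (y - x) powr \<alpha>"
    if g: "gap J a b" and *: "a \<le> x" "x \<le> y" "y \<le> b" for a b x y
  proof (cases "x = y")
    case False
    with * g have pos: "0 < y - x" "y - x \<le> b - a" "0 < b - a" by (auto simp: gap_def)
    have "\<bar>f y - f x\<bar> = \<bar>f b - f a\<bar> / (b - a) * (y - x)"
      using * pos by (subst gap_affine_diff[OF f(1) g]) (auto simp: abs_mult)
    also have "\<dots> \<le> C * (b - a) powr \<alpha> / (b - a) * (y - x)"
      using C[of b a] g pos by (intro mult_right_mono divide_right_mono) (auto simp: gap_def)
    also have "\<dots> = C * ((b - a) powr (\<alpha> - 1) * (y - x))"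
      using pos by (simp add: powr_diff)
    \<comment> \<open>Here \<open>\<alpha> \<le> 1\<close> enters:
      \<open>t powr (\<alpha> - 1)\<close> is nonincreasing, so the slope bound from the whole gap
      only grows on a shorter piece.\<close>
    also have "\<dots> \<le> C * ((y - x) powr (\<alpha> - 1) * (y - x))"
      using pos Cnn \<alpha> by (intro mult_left_mono mult_right_mono powr_mono2') auto
    also have "\<dots> = C * (y - x) powr \<alpha>"
      using pos by (simp add: powr_diff)
    finally show ?thesis .
  qed simp
  have main: "\<bar>f y - f x\<bar> \<le> 3 * C * (y - x) powr \<alpha>"
    if xy: "x \<in> {u..v}" "y \<in> {u..v}" "x < y" for x y
    using xy
  proof (cases rule: point_pair_cases)
    case (same a b)
    then have "\<bar>f y - f x\<bar> \<le> C * (y - x) powr \<alpha>" using gap_bound xy by force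
    also have "\<dots> \<le> 3 * C * (y - x) powr \<alpha>"
      using Cnn by (intro mult_right_mono) auto
    finally show ?thesis .
  next
    case (sep a b)
    have enlarge: "C * (d - c) powr \<alpha> \<le> C * (y - x) powr \<alpha>" if "x \<le> c" "c \<le> d" "d \<le> y" for c d
      using that Cnn \<alpha>0 by (intro mult_left_mono powr_mono2) auto
    have "\<bar>f a - f x\<bar> \<le> C * (a - x) powr \<alpha>" using sep(3,6) gap_bound[of _ a x a] by auto
    also have "\<dots> \<le> C * (y - x) powr \<alpha>" using sep by (intro enlarge) auto
    finally have 1: "\<bar>f a - f x\<bar> \<le> C * (y - x) powr \<alpha>" .
    have "\<bar>f b - f a\<bar> \<le> C * (b - a) powr \<alpha>" using sep C[of b a] by auto
    also have "\<dots> \<le> C * (y - x) powr \<alpha>" using sep by (intro enlarge) auto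
    finally have 2: "\<bar>f b - f a\<bar> \<le> C * (y - x) powr \<alpha>" .
    have "\<bar>f y - f b\<bar> \<le> C * (y - b) powr \<alpha>" using sep(5,7) gap_bound[of b _ b y] by auto
    also have "\<dots> \<le> C * (y - x) powr \<alpha>" using sep by (intro enlarge) auto
    finally have 3: "\<bar>f y - f b\<bar> \<le> C * (y - x) powr \<alpha>" .
    show ?thesis using 1 2 3 by linarith
  qed
  have "\<bar>f x - f y\<bar> \<le> 3 * C * \<bar>x - y\<bar> powr \<alpha>" if "x \<in> {u..v}" "y \<in> {u..v}" for x y
  proof (cases x y rule: linorder_cases)
    case less
    then show ?thesis using main[OF that] by (simp add: abs_minus_commute)
  next
    case greater
    then show ?thesis using main[OF that(2,1)] by simp
  qed simp
  then show ?thesis unfolding holder_on_def using \<alpha>0 by blast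
qed

lemma gap_affine_has_derivative:
  assumes "gap_affine J f" "x \<in> {u..v}" "x \<notin> J"
  obtains a b where "gap J a b" "(f has_real_derivative (f b - f a) / (b - a)) (at x)"
proof -
  obtain a b where g: "gap J a b" "a < x" "x < b" using gap_containing[OF assms(2,3)] by blast
  have "((\<lambda>x. f a + s * (x - a)) has_real_derivative s) (at x)" for s
    by (auto intro!: derivative_eq_intros)
  then have "(f has_real_derivative (f b - f a) / (b - a)) (at x)"
  proof (rule has_field_derivative_transform_within_open)
    show "f a + (f b - f a) / (b - a) * (y - a) = f y" if "y \<in> {a<..<b}" for y
      by (rule gap_affineD[OF assms(1) g(1), symmetric]) (use that in auto)
  qed (use g in auto)
  then show ?thesis using that g(1) by blast
qed

lemma gap_affine_bounds:
  assumes f: "gap_affine J f" "f ` J \<subseteq> {c..d}" and x: "x \<in> {u..v}"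
  shows "f x \<in> {c..d}"
proof (cases "x \<in> J")
  case False
  then obtain a b where g: "gap J a b" "a < x" "x < b" using gap_containing[OF x] by blast
  have "f a \<in> {c..d}" "f b \<in> {c..d}" using g f(2) by (auto simp: gap_def)
  moreover define s where "s = (x - a) / (b - a)"
  moreover have "0 \<le> s" "s \<le> 1" using g by (auto simp: s_def)
  moreover have "f x = (1 - s) *\<^sub>R f a + s *\<^sub>R f b"
  proof -
    have "f x = f a + (f b - f a) * s" using gap_affineD[OF f(1) g(1), of x] g by (simp add: s_def)
    then show ?thesis by (simp add: algebra_simps)
  qed
  ultimately show ?thesis
    using convexD[OF convex_real_interval(5)[of c d], of "f a" "f b" "1 - s" s] by simp
qed (use f in auto)

section \<open>Existence, uniqueness and description by components of the gap-wise affine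
  extension\<close>

lemma gap_affine_extension:
  obtains F where "gap_affine J F" "\<And>x. x \<in> J \<Longrightarrow> F x = f x"
proof -
  \<comment> \<open>The choice is harmless: gaps with a common interior point coincide by
    \<open>gap_unique\<close>.\<close>
  define F where "F x = (if x \<in> J then f x else
    (let (a, b) = (SOME (a, b). gap J a b \<and> a < x \<and> x < b)
     in f a + (f b - f a) / (b - a) * (x - a)))" for x
  have J: "F x = f x" if "x \<in> J" for x using that by (simp add: F_def)
  have "F x = F a + (F b - F a) / (b - a) * (x - a)" if g: "gap J a b" "a \<le> x" "x \<le> b" for a b x
  proof -
    consider "x = a" | "x = b" | "a < x" "x < b" using g by force
    then show ?thesis
    proof cases
      case 3
      have "(case (SOME (a, b). gap J a b \<and> a < x \<and> x < b) of (a, b) \<Rightarrow> gap J a b \<and> a < x \<and> x < b)"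
        by (rule someI[of _ "(a, b)"]) (use g 3 in auto)
      then have "(SOME (a, b). gap J a b \<and> a < x \<and> x < b) = (a, b)"
        using gap_unique[OF g(1) _ 3] by (auto split: prod.splits)
      moreover have "x \<notin> J" using gapD[OF g(1)] 3 by force
      ultimately show ?thesis using J g(1) by (simp add: F_def gap_def)
    qed (use g(1) in \<open>auto simp: gap_def\<close>)
  qed
  then have "gap_affine J F" unfolding gap_affine_def by blast
  with J that show ?thesis by blast
qed

text \<open>A component is connected and misses both ends of the gap around any of its points, so it
  stays inside that gap.\<close>

lemma gap_affine_on_components:
  assumes "gap_affine J f" "C \<in> components ({u..v} - J)"
  shows "affine_fun_on C f"
proof -
  obtain x where x: "x \<in> C" using assms(2) in_components_nonempty by blast
  have C: "C \<subseteq> {u..v} - J" "connected C"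
    using assms(2) in_components_subset in_components_connected by blast+
  with x obtain a b where g: "gap J a b" "a < x" "x < b" using gap_containing by blast
  have ab: "a < y \<and> y < b" if "y \<in> C" for y
  proof -
    have "a \<notin> C" "b \<notin> C" using C g by (auto simp: gap_def)
    moreover have "z \<in> C" if "x \<le> z" "z \<le> y" for z
      using connectedD_interval[OF C(2) x \<open>y \<in> C\<close> that] .
    moreover have "z \<in> C" if "y \<le> z" "z \<le> x" for z
      using connectedD_interval[OF C(2) \<open>y \<in> C\<close> x that] .
    ultimately show ?thesis using g by (meson less_imp_le not_le)
  qed
  have "f y = (f b - f a) / (b - a) * y + (f a - (f b - f a) / (b - a) * a)" if "y \<in> C" for y
    by (subst gap_affineD[OF assms(1) g(1), of y])
      (use ab[OF that] in \<open>auto simp: right_diff_distrib\<close>)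
  then show ?thesis unfolding affine_fun_on_def by blast
qed

text \<open>An open gap is connected, hence lies in one component. Continuity carries the affine
  formula to the two endpoints, where the values of \<open>f\<close> eliminate \<open>m\<close> and
  \<open>k\<close>.\<close>

lemma gap_affine_if_affine_on_components:
  assumes cont: "continuous_on {u..v} f"
    and aff: "\<forall>C\<in>components ({u..v} - J). affine_fun_on C f"
  shows "gap_affine J f"
  unfolding gap_affine_def
proof (intro allI impI)
  fix a b x assume g: "gap J a b" and x: "a \<le> x" "x \<le> b"
  have ab: "a < b" "{a..b} \<subseteq> {u..v}" using g J_sub by (force simp: gap_def)+
  have sub: "{a<..<b} \<subseteq> {u..v} - J" using g ab by (auto simp: gap_def)
  moreover have "{a<..<b} \<noteq> {}" using ab by simp
  ultimately obtain C where C: "C \<in> components ({u..v} - J)" "{a<..<b} \<subseteq> C"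
    using exists_component_superset[OF sub] by (metis connected_Ioo subset_empty)
  obtain m k where mk: "\<forall>x\<in>C. f x = m * x + k"
    using aff C(1) unfolding affine_fun_on_def by blast
  have eq: "f y = m * y + k" if "y \<in> {a..b}" for y
  proof -
    have "f y - (m * y + k) = 0"
    proof (rule continuous_constant_on_closure[where S = "{a<..<b}" and f = "\<lambda>y. f y - (m * y + k)"])
      show "continuous_on (closure {a<..<b}) (\<lambda>y. f y - (m * y + k))"
        using ab by (auto intro!: continuous_intros continuous_on_subset[OF cont])
    qed (use mk C ab that in auto)
    then show ?thesis by simp
  qed
  have "f a = m * a + k" "f b = m * b + k" "f x = m * x + k" using x ab by (auto intro!: eq)
  then show "f x = f a + (f b - f a) / (b - a) * (x - a)"
    using ab by (simp add: field_simps)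
qed

lemma gap_affine_unique:
  assumes "gap_affine J f" "gap_affine J g" "\<And>x. x \<in> J \<Longrightarrow> f x = g x" "x \<in> {u..v}"
  shows "f x = g x"
proof (cases "x \<in> J")
  case False
  then obtain a b where ab: "gap J a b" "a < x" "x < b" using gap_containing[OF assms(4)] by blast
  then have "f a = g a" "f b = g b" using assms(3) by (auto simp: gap_def)
  then show ?thesis
    using gap_affineD[OF assms(1) ab(1), of x] gap_affineD[OF assms(2) ab(1), of x] ab by simp
qed (use assms in auto)

end

lemma holder_on_imp_continuous_on:
  assumes "holder_on S \<alpha> f"
  shows "continuous_on S f"
proof -
  obtain C where \<alpha>: "0 < \<alpha>" and C: "\<forall>x\<in>S. \<forall>y\<in>S. \<bar>f x - f y\<bar> \<le> C * \<bar>x - y\<bar> powr \<alpha>"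
    using assms unfolding holder_on_def by blast
  have "(f \<longlongrightarrow> f x) (at x within S)" if "x \<in> S" for x
  proof (rule LIM_zero_cancel, rule Lim_null_comparison)
    show "\<forall>\<^sub>F y in at x within S. norm (f y - f x) \<le> C * \<bar>y - x\<bar> powr \<alpha>"
      using C that by (auto simp: eventually_at_filter)
    have "((\<lambda>y. \<bar>y - x\<bar>) \<longlongrightarrow> 0) (at x within S)"
      by (intro tendsto_rabs_zero LIM_zero tendsto_ident_at)
    then have "((\<lambda>y. \<bar>y - x\<bar> powr \<alpha>) \<longlongrightarrow> 0) (at x within S)"
      by (rule tendsto_zero_powrI[OF _ tendsto_const _ \<alpha>]) simp
    then have "((\<lambda>y. C * \<bar>y - x\<bar> powr \<alpha>) \<longlongrightarrow> C * 0) (at x within S)"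
      by (intro tendsto_mult tendsto_const)
    then show "((\<lambda>y. C * \<bar>y - x\<bar> powr \<alpha>) \<longlongrightarrow> 0) (at x within S)" by simp
  qed
  then show ?thesis by (simp add: continuous_on_def)
qed

text \<open>The images of the intervals are disjoint as well, so this is additivity of Lebesgue measure.\<close>

lemma sum_mono_increments_le:
  fixes f :: "real \<Rightarrow> real" and n :: nat
  assumes mono: "mono_on {a..b} f" and "a \<le> b"
    and uv: "\<And>i. i < n \<Longrightarrow> u i \<le> v i \<and> {u i..v i} \<subseteq> {a..b}"
    and disj: "disjoint_family_on (\<lambda>i. {u i<..<v i}) {..<n}"
  shows "(\<Sum>i<n. f (v i) - f (u i)) \<le> f b - f a"
proof -
  have in_ab: "u i \<in> {a..b}" "v i \<in> {a..b}" "u i \<le> v i" if "i < n" for i using uv[OF that] by auto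
  have *: "f x \<le> f y" if "x \<in> {a..b}" "y \<in> {a..b}" "x \<le> y" for x y
    using mono that by (simp add: mono_on_def)
  have dis: "disjoint_family_on (\<lambda>i. {f (u i)<..<f (v i)}) {..<n}"
    unfolding disjoint_family_on_def
  proof (intro ballI impI)
    fix i j assume ij: "i \<in> {..<n}" "j \<in> {..<n}" "i \<noteq> j"
    show "{f (u i)<..<f (v i)} \<inter> {f (u j)<..<f (v j)} = {}"
    \<comment> \<open>Nondegenerate intervals with disjoint interiors are ordered on the line; a
      degenerate one may lie inside another, but its open image is empty.\<close>
    proof (cases "u i < v i \<and> u j < v j")
      case True
      have "{u i<..<v i} \<inter> {u j<..<v j} = {}" using disj ij by (auto simp: disjoint_family_on_def)
      then have "{max (u i) (u j)<..<min (v i) (v j)} = {}" by auto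
      then have "v i \<le> u j \<or> v j \<le> u i" using True by (auto simp: not_less)
      then show ?thesis using *[of "v i" "u j"] *[of "v j" "u i"] in_ab ij by fastforce
    next
      case False
      then have "u i = v i \<or> u j = v j" using in_ab ij by force
      then show ?thesis by auto
    qed
  qed
  have "(\<Sum>i<n. f (v i) - f (u i)) = (\<Sum>i<n. measure lebesgue {f (u i)<..<f (v i)})"
    using * in_ab by (intro sum.cong) auto
  also have "\<dots> = measure lebesgue (\<Union>i<n. {f (u i)<..<f (v i)})"
    by (rule measure_finite_Union[symmetric]) (use dis * in_ab in auto)
  also have "\<dots> \<le> measure lebesgue {f a..f b}"
  proof (rule measure_mono_fmeasurable)
    show "(\<Union>i<n. {f (u i)<..<f (v i)}) \<subseteq> {f a..f b}"
    proof clarify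
      fix i y assume i: "i < n" and "y \<in> {f (u i)<..<f (v i)}"
      moreover have "f a \<le> f (u i)" "f (v i) \<le> f b" using * in_ab[OF i] by auto
      ultimately show "y \<in> {f a..f b}" by auto
    qed
  qed auto
  also have "\<dots> = f b - f a" using *[of a b] \<open>a \<le> b\<close> by simp
  finally show ?thesis .
qed

section \<open>Digit expansions\<close>

lemma digit_seqs_le_1: "c \<in> digit_seqs \<Longrightarrow> c i \<le> 1"
proof -
  assume "c \<in> digit_seqs"
  then have "c i \<in> {0, 1}" by (auto simp: digit_seqs_def Pi_def)
  then show "c i \<le> 1" by auto
qed

lemma digit_seqs_shift: "c \<in> digit_seqs \<Longrightarrow> (\<lambda>i. c (n + i)) \<in> digit_seqs"
  by (auto simp: digit_seqs_def Pi_def)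

lemma digit_seqs_case_nat: "d \<in> {0, 1} \<Longrightarrow> c \<in> digit_seqs \<Longrightarrow> case_nat d c \<in> digit_seqs"
  by (auto simp: digit_seqs_def Pi_def split: nat.splits)

lemma geometric_digits:
  fixes r :: real
  assumes "r > 1"
  shows "(\<lambda>i. 1 / r ^ Suc i) sums (1 / (r - 1))"
proof -
  have "(\<lambda>i. (1 / r) * (1 / r) ^ i) sums ((1 / r) * (1 / (1 - 1 / r)))"
    using assms by (intro sums_mult geometric_sums) auto
  moreover have "(1 / r) * (1 / (1 - 1 / r)) = 1 / (r - 1)" using assms by (simp add: field_simps)
  ultimately show ?thesis by (simp add: power_divide)
qed

lemma digit_term_le:
  fixes r :: real
  assumes "r > 1" "c \<in> digit_seqs"
  shows "real (c i) / r ^ Suc i \<le> 1 / r ^ Suc i"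
  using assms digit_seqs_le_1[of c i] by (intro divide_right_mono) auto

lemma summable_digits:
  fixes r :: real
  assumes "r > 1" "c \<in> digit_seqs"
  shows "summable (\<lambda>i. real (c i) / r ^ Suc i)"
  by (rule summable_comparison_test'[OF sums_summable[OF geometric_digits[OF assms(1)]]])
    (use digit_term_le[OF assms] assms in auto)

lemma digit_val_bounds:
  assumes "r > 1" "c \<in> digit_seqs"
  shows "0 \<le> digit_val r c" "digit_val r c \<le> 1 / (r - 1)"
proof -
  show "0 \<le> digit_val r c"
    unfolding digit_val_def using assms by (intro suminf_nonneg summable_digits) auto
  show "digit_val r c \<le> 1 / (r - 1)"
    unfolding digit_val_def sums_unique[OF geometric_digits[OF assms(1)]]
    by (rule suminf_le[OF digit_term_le[OF assms] summable_digits[OF assms]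
          sums_summable[OF geometric_digits[OF assms(1)]]])
qed

lemma digit_val_split:
  assumes "r > 1" "c \<in> digit_seqs"
  shows "digit_val r c = (real (c 0) + digit_val r (\<lambda>i. c (Suc i))) / r"
proof -
  have "digit_val r c = real (c 0) / r + (\<Sum>i. real (c (Suc i)) / r ^ Suc (Suc i))"
    unfolding digit_val_def using suminf_split_head[OF summable_digits[OF assms]] by simp
  also have "(\<Sum>i. real (c (Suc i)) / r ^ Suc (Suc i)) = (\<Sum>i. real (c (Suc i)) / r ^ Suc i / r)"
    by (simp add: mult.commute)
  also have "\<dots> = digit_val r (\<lambda>i. c (Suc i)) / r"
    unfolding digit_val_def
    using suminf_divide[OF summable_digits[OF assms(1) digit_seqs_shift[OF assms(2), of 1]]] by simp
  finally show ?thesis by (simp add: add_divide_distrib)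
qed

lemma digit_val_diff_shift:
  assumes "r > 1" "c \<in> digit_seqs" "d \<in> digit_seqs" "\<forall>i<n. c i = d i"
  shows "digit_val r d - digit_val r c
       = (digit_val r (\<lambda>i. d (n + i)) - digit_val r (\<lambda>i. c (n + i))) / r ^ n"
  using assms(4)
proof (induction n)
  case (Suc n)
  have "digit_val r d - digit_val r c
       = (digit_val r (\<lambda>i. d (n + i)) - digit_val r (\<lambda>i. c (n + i))) / r ^ n"
    using Suc by simp
  also have "digit_val r (\<lambda>i. d (n + i)) = (real (d n) + digit_val r (\<lambda>i. d (Suc n + i))) / r"
    using digit_val_split[OF assms(1) digit_seqs_shift[OF assms(3), of n]] by simp
  also have "digit_val r (\<lambda>i. c (n + i)) = (real (c n) + digit_val r (\<lambda>i. c (Suc n + i))) / r"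
    using digit_val_split[OF assms(1) digit_seqs_shift[OF assms(2), of n]] by simp
  finally show ?case using Suc.prems by (simp add: add_divide_distrib diff_divide_distrib)
qed simp

text \<open>Cancelling the \<open>n\<close> common digits scales the difference by
  \<open>1 / r ^ n\<close> and leaves two values in \<open>{0..1 / (r - 1)}\<close>, which gives the
  upper bound. Both bounds hold for all \<open>r > 1\<close>, but the lower one is nonnegative only
  for \<open>r \<ge> 2\<close> and positive only for \<open>r > 2\<close>.\<close>

lemma digit_val_diff_first:
  assumes "r > 1" "c \<in> digit_seqs" "d \<in> digit_seqs" "\<forall>i<n. c i = d i" "c n = 0" "d n = 1"
  shows "(r - 2) / (r - 1) / r ^ Suc n \<le> digit_val r d - digit_val r c"
    and "\<bar>digit_val r d - digit_val r c\<bar> \<le> 1 / (r - 1) / r ^ n"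
proof -
  define s t where "s = digit_val r (\<lambda>i. c (n + i))" and "t = digit_val r (\<lambda>i. d (n + i))"
  have eq: "digit_val r d - digit_val r c = (t - s) / r ^ n"
    using digit_val_diff_shift[OF assms(1-4)] by (simp add: s_def t_def)
  have st: "0 \<le> s" "s \<le> 1 / (r - 1)" "0 \<le> t" "t \<le> 1 / (r - 1)"
    unfolding s_def t_def using assms by (auto intro!: digit_val_bounds digit_seqs_shift)
  have "\<bar>t - s\<bar> / r ^ n \<le> 1 / (r - 1) / r ^ n"
    using st assms(1) by (intro divide_right_mono) auto
  then show "\<bar>digit_val r d - digit_val r c\<bar> \<le> 1 / (r - 1) / r ^ n"
    using assms(1) eq by simp
  have s': "s = digit_val r (\<lambda>i. c (Suc n + i)) / r"
    unfolding s_def using digit_val_split[OF assms(1) digit_seqs_shift[OF assms(2), of n]] assms(5) by simp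
  have t': "t = (1 + digit_val r (\<lambda>i. d (Suc n + i))) / r"
    unfolding t_def using digit_val_split[OF assms(1) digit_seqs_shift[OF assms(3), of n]] assms(6) by simp
  \<comment> \<open>The extreme case is a zero tail after the digit 1 of \<open>d\<close> and the
    maximal tail \<open>1 / (r - 1)\<close> after the digit 0 of \<open>c\<close>.\<close>
  have "(1 - 1 / (r - 1)) / r \<le> t - s"
    unfolding s' t' diff_divide_distrib[symmetric] using assms(1)
      digit_val_bounds[OF assms(1) digit_seqs_shift[OF assms(2), of "Suc n"]]
      digit_val_bounds[OF assms(1) digit_seqs_shift[OF assms(3), of "Suc n"]]
    by (intro divide_right_mono) auto
  moreover have "1 - 1 / (r - 1) = (r - 2) / (r - 1)" using assms(1) by (simp add: field_simps)
  ultimately have "(r - 2) / (r - 1) / r / r ^ n \<le> (t - s) / r ^ n"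
    using assms(1) by (intro divide_right_mono) auto
  then show "(r - 2) / (r - 1) / r ^ Suc n \<le> digit_val r d - digit_val r c"
    unfolding eq by simp
qed

lemma digit_seqs_first_difference:
  assumes "c \<in> digit_seqs" "d \<in> digit_seqs" "c \<noteq> d"
  obtains n where "\<forall>i<n. c i = d i" "c n = 0 \<and> d n = 1 \<or> c n = 1 \<and> d n = 0"
proof -
  define n where "n = (LEAST n. c n \<noteq> d n)"
  have "\<exists>n. c n \<noteq> d n" using assms(3) by auto
  then have "c n \<noteq> d n" unfolding n_def by (rule LeastI_ex)
  moreover have "\<forall>i<n. c i = d i" using not_less_Least unfolding n_def by blast
  moreover have "c n \<in> {0, 1}" "d n \<in> {0, 1}" using assms(1,2) by (auto simp: digit_seqs_def Pi_def)
  ultimately show ?thesis by (intro that[of n]) auto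
qed

lemma digit_val_inj:
  assumes "r > 2" "c \<in> digit_seqs" "d \<in> digit_seqs" "digit_val r c = digit_val r d"
  shows "c = d"
proof (rule ccontr)
  assume "c \<noteq> d"
  then obtain n where n: "\<forall>i<n. c i = d i" "c n = 0 \<and> d n = 1 \<or> c n = 1 \<and> d n = 0"
    using digit_seqs_first_difference assms(2,3) by metis
  have "0 < (r - 2) / (r - 1) / r ^ Suc n" using assms(1) by auto
  moreover have "(r - 2) / (r - 1) / r ^ Suc n \<le> 0"
    using n(2) digit_val_diff_first(1)[of r c d n] digit_val_diff_first(1)[of r d c n] n(1) assms
    by fastforce
  ultimately show False by linarith
qed

text \<open>Injectivity of \<open>digit_val p\<close> makes the definite description in
  \<open>digits\<close> recover \<open>c\<close>.\<close>

lemma base_change_digit_val: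
  assumes "p > 2" "c \<in> digit_seqs"
  shows "base_change p q (digit_val p c) = digit_val q c"
proof -
  have "digits p (digit_val p c) = c"
    unfolding digits_def using assms digit_val_inj by (intro the_equality) auto
  then show ?thesis by (simp add: base_change_def)
qed

section \<open>The Cantor set of digit values: compactness, self-similarity, measure\<close>

lemma compact_J_set:
  assumes "r > 1"
  shows "compact (J_set r)"
  unfolding J_set_def
proof (rule compact_continuous_image)
  have "compactin (product_topology (\<lambda>_. euclidean) UNIV) (PiE UNIV (\<lambda>_::nat. {0, 1::nat}))"
    by (subst compactin_PiE) auto
  then show "compact digit_seqs"
    by (simp add: euclidean_product_topology digit_seqs_def compactin_euclidean_iff PiE_UNIV_domain)
  show "continuous_on digit_seqs (digit_val r)"
    unfolding digit_val_def
  \<comment> \<open>The partial sums depend on finitely many coordinates and converge uniformly in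
    \<open>c\<close>, being dominated by the geometric series.\<close>
  proof (rule uniform_limit_theorem)
    show "uniform_limit digit_seqs (\<lambda>n c. \<Sum>i<n. real (c i) / r ^ Suc i)
            (\<lambda>c. \<Sum>i. real (c i) / r ^ Suc i) sequentially"
      by (rule Weierstrass_m_test[OF _ sums_summable[OF geometric_digits[OF assms]]])
        (use digit_term_le[OF assms] assms in auto)
    have digit: "continuous_on digit_seqs (\<lambda>c. real (c i))" for i
    proof (rule continuous_on_compose2[of UNIV real])
      show "continuous_on digit_seqs (\<lambda>c. c i)"
        by (rule continuous_on_subset[OF continuous_on_product_coordinates]) simp
    qed (auto intro: continuous_on_of_nat continuous_on_id)
    then show "\<forall>\<^sub>F n in sequentially. continuous_on digit_seqs (\<lambda>c. \<Sum>i<n. real (c i) / r ^ Suc i)"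
      using assms
      by (intro always_eventually allI continuous_on_sum continuous_on_divide digit continuous_on_const) auto
  qed simp
qed

lemma J_set_bounds:
  assumes "r > 1" "x \<in> J_set r"
  shows "0 \<le> x" "x \<le> 1 / (r - 1)"
  using assms digit_val_bounds by (auto simp: J_set_def)

lemma zero_in_J_set: "0 \<in> J_set r"
proof -
  have "digit_val r (\<lambda>_. 0) = 0" by (simp add: digit_val_def)
  moreover have "(\<lambda>_. 0) \<in> digit_seqs" by (auto simp: digit_seqs_def)
  ultimately show ?thesis unfolding J_set_def by (metis imageI)
qed

lemma digit_val_ones: "r > 1 \<Longrightarrow> digit_val r (\<lambda>_. 1) = 1 / (r - 1)"
  unfolding digit_val_def using sums_unique[OF geometric_digits[of r]] by simp

lemma digit_seqs_const: "(\<lambda>_. 0) \<in> digit_seqs" "(\<lambda>_. 1) \<in> digit_seqs"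
  by (auto simp: digit_seqs_def)

lemma max_in_J_set: "r > 1 \<Longrightarrow> 1 / (r - 1) \<in> J_set r"
  using digit_val_ones digit_seqs_const unfolding J_set_def by (metis imageI)

lemma J_set_cases:
  assumes "r > 1" "x \<in> J_set r"
  obtains z where "z \<in> J_set r" "x = z / r" | z where "z \<in> J_set r" "x = (1 + z) / r"
proof -
  obtain c where c: "c \<in> digit_seqs" "x = digit_val r c" using assms(2) by (auto simp: J_set_def)
  have "digit_val r (\<lambda>i. c (Suc i)) \<in> J_set r"
    using digit_seqs_shift[OF c(1), of 1] by (auto simp: J_set_def)
  moreover have "c 0 \<in> {0, 1}" using c(1) by (auto simp: digit_seqs_def Pi_def)
  ultimately show ?thesis using digit_val_split[OF assms(1) c(1)] c(2) that by auto
qed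

lemma J_set_step:
  assumes "r > 1" "x \<in> J_set r"
  shows "x / r \<in> J_set r" "(1 + x) / r \<in> J_set r"
proof -
  obtain c where c: "c \<in> digit_seqs" "x = digit_val r c" using assms(2) by (auto simp: J_set_def)
  have "(real d + x) / r \<in> J_set r" if "d \<in> {0, 1}" for d
    using digit_seqs_case_nat[OF that c(1)] digit_val_split[OF assms(1), of "case_nat d c"] c(2)
    unfolding J_set_def by (intro image_eqI[of _ _ "case_nat d c"]) auto
  from this[of 0] this[of 1] show "x / r \<in> J_set r" "(1 + x) / r \<in> J_set r" by auto
qed

text \<open>Prepending a digit \<open>d\<close> is the map \<open>x \<mapsto> (d + x) / p\<close> in
  base \<open>p\<close> and \<open>y \<mapsto> (d + y) / q\<close> in base \<open>q\<close>, and
  base change preserves digits.\<close>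

lemma base_change_self_similar:
  assumes "p > 2" "q > 1" "x \<in> J_set p"
  shows "base_change p q (x / p) = base_change p q x / q"
    and "base_change p q ((1 + x) / p) = (1 + base_change p q x) / q"
proof -
  obtain c where c: "c \<in> digit_seqs" "x = digit_val p c" using assms(3) by (auto simp: J_set_def)
  have "base_change p q ((real d + x) / p) = (real d + base_change p q x) / q" if "d \<in> {0, 1}" for d
  proof -
    have dc: "case_nat d c \<in> digit_seqs" by (rule digit_seqs_case_nat[OF that c(1)])
    have "(real d + x) / p = digit_val p (case_nat d c)"
      using digit_val_split[OF _ dc, of p] assms(1) c by simp
    then have "base_change p q ((real d + x) / p) = digit_val q (case_nat d c)"
      using base_change_digit_val[OF assms(1) dc] by simp
    then show ?thesis
      using digit_val_split[OF assms(2) dc] base_change_digit_val[OF assms(1) c(1)] c(2) by simp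
  qed
  from this[of 0] this[of 1] show "base_change p q (x / p) = base_change p q x / q"
    and "base_change p q ((1 + x) / p) = (1 + base_change p q x) / q" by auto
qed

text \<open>The set is covered by two copies of itself scaled by \<open>1 / r\<close>, so its finite
  measure satisfies \<open>m \<le> 2 * m / r\<close>; as \<open>r > 2\<close>, it vanishes.\<close>

lemma negligible_J_set:
  assumes "r > 2"
  shows "negligible (J_set r)"
proof -
  define m where "m = measure lebesgue (J_set r)"
  have lm: "J_set r \<in> lmeasurable" using compact_J_set assms by (intro lmeasurable_compact) auto
  have img: "(\<lambda>x. x / r) ` J_set r = (\<lambda>x. (1 / r) *\<^sub>R x + 0) ` J_set r"
    "(\<lambda>x. (1 + x) / r) ` J_set r = (\<lambda>x. (1 / r) *\<^sub>R x + 1 / r) ` J_set r"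
    by (auto simp: add_divide_distrib)
  have meas: "(\<lambda>x. x / r) ` J_set r \<in> lmeasurable" "(\<lambda>x. (1 + x) / r) ` J_set r \<in> lmeasurable"
    using compact_J_set assms
    by (auto intro!: lmeasurable_compact compact_continuous_image continuous_intros)
  have "m \<le> measure lebesgue ((\<lambda>x. x / r) ` J_set r) + measure lebesgue ((\<lambda>x. (1 + x) / r) ` J_set r)"
  proof -
    have "J_set r \<subseteq> (\<lambda>x. x / r) ` J_set r \<union> (\<lambda>x. (1 + x) / r) ` J_set r"
      using J_set_cases assms by (smt (verit, best) UnI1 UnI2 image_eqI subsetI)
    then have "m \<le> measure lebesgue ((\<lambda>x. x / r) ` J_set r \<union> (\<lambda>x. (1 + x) / r) ` J_set r)"
      unfolding m_def by (rule measure_mono_fmeasurable) (use lm meas in auto)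
    also note measure_Un_le
    finally show ?thesis using meas by auto
  qed
  also have "\<dots> = 1 / r * m + 1 / r * m"
    using assms measure_lebesgue_affine[of "1 / r" 0 "J_set r"]
      measure_lebesgue_affine[of "1 / r" "1 / r" "J_set r"]
    unfolding img by (simp add: m_def)
  finally have "m * (r - 2) \<le> 0" using assms by (simp add: field_simps)
  then have "m = 0" using assms measure_nonneg[of lebesgue "J_set r"]
    by (simp add: m_def mult_le_0_iff)
  then show ?thesis using lm by (simp add: negligible_iff_measure m_def)
qed

section \<open>Order and Hoelder estimates for base change on the Cantor set\<close>

lemma base_change_bounds:
  assumes "p > 2" "q > 1" "x \<in> J_set p"
  shows "base_change p q x \<in> {0..1 / (q - 1)}"
  using assms base_change_digit_val digit_val_bounds by (auto simp: J_set_def)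

text \<open>For \<open>p > 2\<close> the order on \<open>J_set p\<close> is the lexicographic order
  of digits. The lower bound of \<open>digit_val_diff_first\<close> in base \<open>q\<close> turns
  this into an inequality between the images.\<close>

lemma base_change_mono:
  assumes "p > 2" "q \<ge> 2" "x \<in> J_set p" "y \<in> J_set p" "x < y"
  shows "base_change p q x \<le> base_change p q y"
    and "q > 2 \<Longrightarrow> base_change p q x < base_change p q y"
proof -
  obtain c d where c: "c \<in> digit_seqs" "x = digit_val p c" and d: "d \<in> digit_seqs" "y = digit_val p d"
    using assms(3,4) by (auto simp: J_set_def)
  have "c \<noteq> d" using assms c d by auto
  then obtain n where n: "\<forall>i<n. c i = d i" "c n = 0 \<and> d n = 1 \<or> c n = 1 \<and> d n = 0"
    using digit_seqs_first_difference c(1) d(1) by metis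
  have "c n = 0 \<and> d n = 1"
  proof (rule ccontr)
    assume "\<not> ?thesis"
    then have "(p - 2) / (p - 1) / p ^ Suc n \<le> x - y"
      unfolding c d using n c d assms by (intro digit_val_diff_first) auto
    moreover have "0 < (p - 2) / (p - 1) / p ^ Suc n" using assms by auto
    ultimately show False using assms by linarith
  qed
  then have le: "(q - 2) / (q - 1) / q ^ Suc n \<le> base_change p q y - base_change p q x"
    unfolding c d using base_change_digit_val[OF assms(1)] digit_val_diff_first(1)[of q c d n] c(1) d(1) n(1) assms
    by auto
  have "0 \<le> (q - 2) / (q - 1) / q ^ Suc n" using assms by auto
  then show "base_change p q x \<le> base_change p q y" using le by linarith
  assume "q > 2"
  then have "0 < (q - 2) / (q - 1) / q ^ Suc n" by auto
  then show "base_change p q x < base_change p q y" using le by linarith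
qed

text \<open>If the digits first differ at \<open>n\<close>, the points are at least of order
  \<open>p ^ -n\<close> apart and the images at most of order \<open>q ^ -n\<close>; the exponent is
  chosen so that \<open>p powr \<alpha> \<le> q\<close>.\<close>

lemma base_change_holder:
  assumes "p > 2" "q > 1"
  shows "holder_on (J_set p) (min 1 (ln q / ln p)) (base_change p q)"
proof -
  define \<alpha> where "\<alpha> = min 1 (ln q / ln p)"
  have \<alpha>: "0 < \<alpha>" using assms by (auto simp: \<alpha>_def)
  have "p powr \<alpha> \<le> p powr (ln q / ln p)" using assms by (intro powr_mono) (auto simp: \<alpha>_def)
  also have "\<dots> = q" using assms by (simp add: powr_def)
  finally have pq: "p powr \<alpha> \<le> q" .
  \<comment> \<open>Normalised so that \<open>K\<close> times the separation bound at index
    \<open>n\<close> is exactly \<open>1 / p ^ n\<close>.\<close>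
  define K where "K = p * (p - 1) / (p - 2)"
  have K: "0 < K" using assms by (simp add: K_def)
  have "\<bar>base_change p q x - base_change p q y\<bar> \<le> (1 / (q - 1) * K powr \<alpha>) * \<bar>x - y\<bar> powr \<alpha>"
    if xy: "x \<in> J_set p" "y \<in> J_set p" for x y
  proof (cases "x = y")
    case False
    obtain c d where c: "c \<in> digit_seqs" "x = digit_val p c" and d: "d \<in> digit_seqs" "y = digit_val p d"
      using xy by (auto simp: J_set_def)
    have "c \<noteq> d" using False c d by auto
    then obtain n where n: "\<forall>i<n. c i = d i" "c n = 0 \<and> d n = 1 \<or> c n = 1 \<and> d n = 0"
      using digit_seqs_first_difference c(1) d(1) by metis
    have "(p - 2) / (p - 1) / p ^ Suc n \<le> \<bar>x - y\<bar>"
      using digit_val_diff_first(1)[of p c d n] digit_val_diff_first(1)[of p d c n] n c d assms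
      by (auto simp: abs_if split: if_splits)
    then have "K * ((p - 2) / (p - 1) / p ^ Suc n) \<le> K * \<bar>x - y\<bar>"
      using K by (intro mult_left_mono) auto
    moreover have "K * ((p - 2) / (p - 1) / p ^ Suc n) = 1 / p ^ n"
      using assms by (simp add: K_def)
    ultimately have xy': "1 / p ^ n \<le> K * \<bar>x - y\<bar>" by simp
    have "\<bar>base_change p q x - base_change p q y\<bar> \<le> 1 / (q - 1) / q ^ n"
      unfolding c d base_change_digit_val[OF assms(1) c(1)] base_change_digit_val[OF assms(1) d(1)]
      using digit_val_diff_first(2)[of q c d n] digit_val_diff_first(2)[of q d c n] n c(1) d(1) assms
      by (auto simp: abs_minus_commute)
    also have "\<dots> \<le> 1 / (q - 1) / (p powr \<alpha>) ^ n"
      using pq assms by (intro divide_left_mono power_mono mult_pos_pos zero_less_power) auto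
    also have "\<dots> = 1 / (q - 1) * (1 / p ^ n) powr \<alpha>"
    proof -
      have "(p ^ n) powr \<alpha> = p powr (real n * \<alpha>)"
        using assms by (subst powr_realpow[symmetric]) (auto simp: powr_powr)
      also have "\<dots> = (p powr \<alpha>) ^ n"
        using assms by (subst powr_realpow[symmetric]) (auto simp: powr_powr mult.commute)
      finally show ?thesis using assms by (simp add: powr_divide)
    qed
    also have "\<dots> \<le> 1 / (q - 1) * (K * \<bar>x - y\<bar>) powr \<alpha>"
      using xy' assms \<alpha> by (intro mult_left_mono powr_mono2) auto
    also have "\<dots> = (1 / (q - 1) * K powr \<alpha>) * \<bar>x - y\<bar> powr \<alpha>"
      using K by (simp add: powr_mult)
    finally show ?thesis .
  qed simp
  then show ?thesis using \<alpha> unfolding holder_on_def \<alpha>_def[symmetric] by blast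
qed

section \<open>The base-change function\<close>

text \<open>The indices \<open>0, \<dots>, 2 ^ (n + 1) - 1\<close> enumerate in increasing order the endpoints of the
  \<open>2 ^ n\<close> intervals left after \<open>n\<close> steps of the Cantor construction; the pair \<open>2 * k, 2 * k + 1\<close>
  bounds the \<open>k\<close>-th of them.\<close>

primrec level_endpoint :: "real \<Rightarrow> nat \<Rightarrow> nat \<Rightarrow> real" where
  "level_endpoint p 0 i = (if i = 0 then 0 else 1 / (p - 1))"
| "level_endpoint p (Suc n) i =
     (if i < 2 ^ Suc n then level_endpoint p n i / p
      else (1 + level_endpoint p n (i - 2 ^ Suc n)) / p)"

text \<open>With endpoints enumerated in pairs, the even steps cross the intervals of a level and
  the odd steps cross the gaps; the latter are discarded.\<close>

lemma sum_even_le: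
  fixes g :: "nat \<Rightarrow> real"
  assumes "\<And>i. i < 2 * m - 1 \<Longrightarrow> 0 \<le> g i"
  shows "(\<Sum>k<m. g (2 * k)) \<le> (\<Sum>i<2 * m - 1. g i)"
proof -
  have "(\<Sum>k<m. g (2 * k)) = sum g ((\<lambda>k. 2 * k) ` {..<m})"
    by (subst sum.reindex) (auto simp: inj_on_def)
  also have "\<dots> \<le> (\<Sum>i<2 * m - 1. g i)"
    by (rule sum_mono2) (use assms in auto)
  finally show ?thesis .
qed

locale base_change_pair =
  fixes p q :: real
  assumes p: "p > 2" and q: "q > 1"
begin

abbreviation "J \<equiv> J_set p"
abbreviation "L \<equiv> 1 / (p - 1)"
abbreviation "M \<equiv> 1 / (q - 1)"
abbreviation "B \<equiv> base_change_ext p q"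

text \<open>\<open>p * L = 1 + L\<close> says that \<open>L\<close> is the fixed point of
  \<open>x \<mapsto> (1 + x) / p\<close>; \<open>L / p < 1 / p\<close> separates the two halves of
  \<open>J\<close>.\<close>

lemma L_bounds: "0 < L" "L < 1" "p * L = 1 + L" "L / p < 1 / p" "1 / p < L"
  using p by (auto simp: field_simps)

lemma M_bounds: "0 < M" "q * M = 1 + M"
  using q by (auto simp: field_simps)

sublocale closed_hull J 0 L
  by unfold_locales
    (use p compact_J_set[of p] J_set_bounds[of p] zero_in_J_set max_in_J_set in
      \<open>auto simp: compact_imp_closed\<close>)

text \<open>Resolves the definite description. The restricted gap-wise affine extension is a
  candidate, its continuity coming from the Hoelder bound. Any other candidate is gap-wise affine
  with the same values on \<open>J\<close>, and extensionality settles the points outside the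
  interval.\<close>

lemma gap_affine_B: "gap_affine J B"
  and B_on_J: "x \<in> J \<Longrightarrow> B x = base_change p q x"
proof -
  obtain F where F: "gap_affine J F" "\<And>x. x \<in> J \<Longrightarrow> F x = base_change p q x"
    using gap_affine_extension by metis
  define G where "G = restrict F {0..L}"
  have GJ: "G x = base_change p q x" if "x \<in> J" for x
    using that F(2) J_sub by (auto simp: G_def)
  have gapI: "x \<in> {0..L}" if "gap J a b" "a \<le> x" "x \<le> b" for a b x
    using that J_sub by (force simp: gap_def)
  have G: "gap_affine J G"
    unfolding gap_affine_def
  proof (intro allI impI)
    fix a b x assume g: "gap J a b" "a \<le> x" "x \<le> b"
    have "G a = F a" "G b = F b" "G x = F x"
      using gapI[OF g(1)] g by (auto simp: G_def)
    then show "G x = G a + (G b - G a) / (b - a) * (x - a)" using gap_affineD[OF F(1) g] by simp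
  qed
  have "G \<in> {0..L} \<rightarrow>\<^sub>E {0..M}"
  proof (rule PiE_I)
    fix x assume "x \<in> {0..L}"
    then show "G x \<in> {0..M}"
      by (rule gap_affine_bounds[OF G, rotated]) (use GJ base_change_bounds[OF p q] in auto)
  qed (auto simp: G_def)
  moreover have "continuous_on {0..L} G"
  proof (rule holder_on_imp_continuous_on, rule holder_on_hull[OF G])
    show "holder_on J (min 1 (ln q / ln p)) G"
      using base_change_holder[OF p q] GJ by (simp add: holder_on_def)
  qed simp
  ultimately have "B = G"
    unfolding base_change_ext_def
  proof (intro the_equality conjI)
    fix H assume H: "H \<in> {0..L} \<rightarrow>\<^sub>E {0..M} \<and> continuous_on {0..L} H \<and>
      (\<forall>x\<in>J. H x = base_change p q x) \<and> (\<forall>C\<in>components ({0..L} - J). affine_fun_on C H)"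
    then have "gap_affine J H" by (intro gap_affine_if_affine_on_components) auto
    then have "H x = G x" if "x \<in> {0..L}" for x
      using gap_affine_unique[OF _ G _ that] H GJ by auto
    moreover have "H \<in> extensional {0..L}" "G \<in> extensional {0..L}"
      using H by (auto simp: PiE_def G_def)
    ultimately show "H = G" by (intro extensionalityI) auto
  qed (use GJ gap_affine_on_components[OF G] in auto)
  with G GJ show "gap_affine J B" "x \<in> J \<Longrightarrow> B x = base_change p q x" by auto
qed

lemma B_holder: "holder_on {0..L} (min 1 (ln q / ln p)) B"
proof (rule holder_on_hull[OF gap_affine_B])
  show "holder_on J (min 1 (ln q / ln p)) B"
    using base_change_holder[OF p q] B_on_J by (simp add: holder_on_def)
qed simp

section \<open>Self-similarity of \<open>B\<close> on the whole interval\<close>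

lemma J_step: "x \<in> J \<Longrightarrow> x / p \<in> J" "x \<in> J \<Longrightarrow> (1 + x) / p \<in> J"
  using J_set_step[of p] p by auto

lemma B_step_J:
  assumes "x \<in> J"
  shows "B (x / p) = B x / q" "B ((1 + x) / p) = (1 + B x) / q"
  using base_change_self_similar[OF p q assms] by (simp_all add: B_on_J J_step assms)

lemma B_0: "B 0 = 0"
  using B_on_J[OF u_in] base_change_digit_val[OF p digit_seqs_const(1), of q] by (simp add: digit_val_def)

lemma B_L: "B L = M"
  using B_on_J[OF v_in] base_change_digit_val[OF p digit_seqs_const(2), of q] p q
    digit_val_ones[of p] digit_val_ones[of q]
  by simp

lemma J_cases:
  assumes "y \<in> J"
  obtains z where "z \<in> J" "y = z / p" | z where "z \<in> J" "y = (1 + z) / p"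
  using assms J_set_cases[of p y] p by auto

lemma J_in: "x \<in> J \<Longrightarrow> 0 \<le> x \<and> x \<le> L"
  using J_sub by auto

lemma gap_middle: "gap J (L / p) (1 / p)"
  unfolding gap_def
proof (intro conjI)
  show "L / p \<in> J" using J_step v_in by blast
  show "1 / p \<in> J" using J_step(2)[OF u_in] by simp
  show "L / p < 1 / p" by (rule L_bounds)
  show "{L / p<..<1 / p} \<inter> J = {}"
  proof (rule equals0I)
    fix y assume "y \<in> {L / p<..<1 / p} \<inter> J"
    then have y: "y \<in> J" "L / p < y" "y < 1 / p" by auto
    from y(1) show False
    proof (cases rule: J_cases)
      case (1 z)
      then show False using y p J_in[of z] divide_right_mono[of z L p] by auto
    next
      case (2 z)
      then show False using y p J_in[of z] divide_right_mono[of 1 "1 + z" p] by auto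
    qed
  qed
qed

text \<open>Each of the two similarities maps \<open>J\<close> onto one half of \<open>J\<close>, so
  it could only fail to preserve a gap through points of the other half.\<close>

lemma gap_step:
  assumes "gap J a b"
  shows "gap J (a / p) (b / p)" "gap J ((1 + a) / p) ((1 + b) / p)"
proof -
  have ab: "a \<in> J" "b \<in> J" "a < b" using assms by (auto simp: gap_def)
  have le: "x / p \<le> L / p" "1 / p \<le> (1 + x) / p" if "x \<in> J" for x
    by (rule divide_right_mono; use J_in[OF that] p in simp)+
  note lt = L_bounds(4)
  have "z / p \<le> a / p \<or> b / p \<le> z / p" "(1 + z) / p \<le> (1 + a) / p \<or> (1 + b) / p \<le> (1 + z) / p"
    if "z \<in> J" for z
    using gapD[OF assms that] p by (auto intro: divide_right_mono)
  \<comment> \<open>Points of the other half lie beyond the central gap.\<close>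
  moreover have "b / p \<le> (1 + z) / p" "z / p \<le> (1 + a) / p" if "z \<in> J" for z
    using le[OF that] le[OF ab(1)] le[OF ab(2)] lt by linarith+
  ultimately have no: "y \<le> a / p \<or> b / p \<le> y" "y \<le> (1 + a) / p \<or> (1 + b) / p \<le> y" if "y \<in> J" for y
    using that J_cases by metis+
  have "a / p < b / p" "(1 + a) / p < (1 + b) / p" using ab p by (auto intro: divide_strict_right_mono)
  moreover have "{a / p<..<b / p} \<inter> J = {}" "{(1 + a) / p<..<(1 + b) / p} \<inter> J = {}"
    using no by force+
  ultimately show "gap J (a / p) (b / p)" "gap J ((1 + a) / p) ((1 + b) / p)"
    using ab J_step by (simp_all add: gap_def)
qed

text \<open>On \<open>J\<close> this is the self-similarity of base change. Inside a gap, the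
  similarity carries the gap to a gap and the chord of \<open>B\<close> to its chord.\<close>

lemma B_step:
  assumes x: "x \<in> {0..L}"
  shows "B (x / p) = B x / q" "B ((1 + x) / p) = (1 + B x) / q"
proof -
  have "B (x / p) = B x / q \<and> B ((1 + x) / p) = (1 + B x) / q"
  proof (cases "x \<in> J")
    case False
    then obtain a b where g: "gap J a b" "a < x" "x < b" using gap_containing[OF x] by blast
    then have ab: "a \<in> J" "b \<in> J" "b - a \<noteq> 0" by (auto simp: gap_def)
    have Bx: "B x = B a + (B b - B a) / (b - a) * (x - a)"
      by (rule gap_affineD[OF gap_affine_B g(1)]) (use g in auto)
    have "B (x / p) = B (a / p) + (B (b / p) - B (a / p)) / (b / p - a / p) * (x / p - a / p)"
      by (rule gap_affineD[OF gap_affine_B gap_step(1)[OF g(1)]]) (use g p in \<open>auto intro: divide_right_mono\<close>)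
    also have "\<dots> = B a / q + (B b / q - B a / q) / (b / p - a / p) * (x / p - a / p)"
      by (simp add: B_step_J ab)
    also have "\<dots> = B a / q + (B b - B a) / (b - a) * (x - a) / q"
      using p ab by (simp flip: diff_divide_distrib)
    also have "\<dots> = B x / q" by (simp add: Bx add_divide_distrib)
    finally have 1: "B (x / p) = B x / q" .
    have "B ((1 + x) / p) = B ((1 + a) / p)
        + (B ((1 + b) / p) - B ((1 + a) / p)) / ((1 + b) / p - (1 + a) / p) * ((1 + x) / p - (1 + a) / p)"
      by (rule gap_affineD[OF gap_affine_B gap_step(2)[OF g(1)]]) (use g p in \<open>auto intro: divide_right_mono\<close>)
    also have "\<dots> = (1 + B a) / q
        + ((1 + B b) / q - (1 + B a) / q) / ((1 + b) / p - (1 + a) / p) * ((1 + x) / p - (1 + a) / p)"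
      by (simp add: B_step_J ab)
    also have "\<dots> = (1 + B a) / q + (B b - B a) / (b - a) * (x - a) / q"
      using p ab by (simp flip: diff_divide_distrib)
    also have "\<dots> = (1 + B x) / q" by (simp add: Bx add_divide_distrib)
    finally show ?thesis using 1 by simp
  qed (simp add: B_step_J)
  then show "B (x / p) = B x / q" "B ((1 + x) / p) = (1 + B x) / q" by auto
qed

section \<open>Differentiability almost everywhere and exactness of the exponent\<close>

lemma AE_not_in_J: "AE x in lebesgue. x \<notin> J"
  using negligible_J_set[OF p] by (intro AE_not_in) (simp add: negligible_iff_null_sets)

lemma B_AE_differentiable: "AE x\<in>{0..L} in lebesgue. B differentiable (at x within {0..L})"
  using AE_not_in_J
proof eventually_elim
  case (elim x)
  show ?case
  proof
    assume "x \<in> {0..L}"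
    then obtain D where D: "(B has_real_derivative D) (at x)"
      using gap_affine_has_derivative[OF gap_affine_B _ elim] by blast
    show "B differentiable (at x within {0..L})"
      unfolding real_differentiable_def using has_field_derivative_at_within[OF D] by blast
  qed
qed

lemma B_power: "1 / p ^ Suc n \<in> J \<and> B (1 / p ^ Suc n) = 1 / q ^ Suc n"
proof (induction n)
  case 0
  show ?case using J_step(2)[OF u_in] B_step_J(2)[OF u_in] B_0 by simp
next
  case (Suc n)
  then show ?case using J_step(1)[of "1 / p ^ Suc n"] B_step_J(1)[of "1 / p ^ Suc n"]
    by (simp add: mult.commute)
qed

text \<open>For \<open>q < p\<close>, comparing \<open>1 / p ^ Suc n\<close> with 0 forces
  \<open>C\<close> to dominate the unbounded sequence \<open>(p powr \<beta> / q) ^ Suc n\<close>.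
  For \<open>q \<ge> p\<close> the exponent exceeds 1, which is impossible on the central gap, where
  the slope is positive.\<close>

lemma B_not_holder:
  assumes "min 1 (ln q / ln p) < \<beta>"
  shows "\<not> holder_on {0..L} \<beta> B"
proof
  assume "holder_on {0..L} \<beta> B"
  then obtain C where \<beta>: "0 < \<beta>" and
    C: "\<And>x y. x \<in> {0..L} \<Longrightarrow> y \<in> {0..L} \<Longrightarrow> \<bar>B x - B y\<bar> \<le> C * \<bar>x - y\<bar> powr \<beta>"
    unfolding holder_on_def by blast
  show False
  proof (cases "q < p")
    case True
    then have "ln q / ln p < \<beta>" using assms p q by (auto simp: min_def split: if_splits)
    then have "p powr (ln q / ln p) < p powr \<beta>" using p by (intro powr_less_mono) auto
    moreover have "p powr (ln q / ln p) = q" using p q by (simp add: powr_def)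
    ultimately have "1 < p powr \<beta> / q" using q by simp
    then obtain n where "C < (p powr \<beta> / q) ^ n" using real_arch_pow by blast
    also have "\<dots> \<le> (p powr \<beta> / q) ^ Suc n"
      using \<open>1 < p powr \<beta> / q\<close> by (intro power_increasing) auto
    finally have "C < (p powr \<beta>) ^ Suc n / q ^ Suc n" by (simp only: power_divide)
    moreover have "1 / q ^ Suc n \<le> C * (1 / p ^ Suc n) powr \<beta>"
      using C[of "1 / p ^ Suc n" 0] B_power[of n] J_in[of "1 / p ^ Suc n"] B_0 L_bounds(1) p q by simp
    moreover have "(1 / p ^ Suc n) powr \<beta> = 1 / (p powr \<beta>) ^ Suc n"
    proof -
      have "(p ^ Suc n) powr \<beta> = p powr (real (Suc n) * \<beta>)"
        using p by (subst powr_realpow[symmetric]) (auto simp: powr_powr)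
      also have "\<dots> = (p powr \<beta>) ^ Suc n"
        using p by (subst powr_realpow[symmetric]) (auto simp: powr_powr mult.commute)
      finally show ?thesis using p by (simp add: powr_divide del: power_Suc)
    qed
    moreover have "0 < (p powr \<beta>) ^ Suc n" "0 < q ^ Suc n" using p q by auto
    ultimately show False by (simp add: field_simps del: power_Suc)
  next
    case False
    then have q2: "q > 2" and "\<beta> > 1" using assms p by (auto simp: min_def split: if_splits)
    define a b where "a = L / p" and "b = 1 / p"
    have g: "gap J a b" using gap_middle by (simp add: a_def b_def)
    have ab: "a < b" "a \<in> {0..L}" "b \<in> {0..L}" using g J_in[of a] J_in[of b] by (auto simp: gap_def)
    \<comment> \<open>The central gap has end values \<open>M / q\<close> and \<open>1 / q\<close>;
      they differ because \<open>M < 1\<close> for \<open>q > 2\<close>.\<close>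
    have "B b - B a = (1 - M) / q"
      using B_step_J(1)[OF v_in] B_step_J(2)[OF u_in] B_0 B_L by (simp add: a_def b_def diff_divide_distrib)
    moreover have "M < 1" using q2 by simp
    ultimately have "B b - B a > 0" using q by simp
    then have s: "(B b - B a) / (b - a) > 0" using ab by simp
    \<comment> \<open>The Hoelder bound between \<open>a\<close> and \<open>a + t\<close>, divided
      by \<open>t\<close>: the slope is constant while the right-hand side tends to 0.\<close>
    have "\<forall>\<^sub>F t in at_right 0. (B b - B a) / (b - a) \<le> C * t powr (\<beta> - 1)"
    proof (rule eventually_at_rightI[of 0 "b - a"])
      fix t assume "t \<in> {0<..<b - a}"
      then have t: "0 < t" "a + t < b" by auto
      have "B (a + t) - B a = (B b - B a) / (b - a) * t"
        using gap_affine_diff[OF gap_affine_B g, of a "a + t"] t ab by simp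
      moreover have "\<bar>B (a + t) - B a\<bar> \<le> C * \<bar>(a + t) - a\<bar> powr \<beta>" using t ab by (intro C) auto
      ultimately have "(B b - B a) / (b - a) * t \<le> C * t powr \<beta>"
        using t abs_le_D1[of "B (a + t) - B a"] by simp
      then show "(B b - B a) / (b - a) \<le> C * t powr (\<beta> - 1)"
        using t by (simp add: powr_diff pos_le_divide_eq)
    qed (use ab in auto)
    moreover have "((\<lambda>t. C * t powr (\<beta> - 1)) \<longlongrightarrow> C * 0) (at_right 0)"
      using \<open>\<beta> > 1\<close> by (intro tendsto_mult tendsto_const tendsto_zero_powrI[where b = "\<beta> - 1"])
        (auto simp: eventually_at_filter)
    ultimately have "(B b - B a) / (b - a) \<le> C * 0"
      by (intro tendsto_lowerbound[where F = "at_right 0"]) auto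
    with s show False by simp
  qed
qed

section \<open>Endpoints of level \<open>n\<close>, and unbounded variation for
  \<open>q < 2\<close>\<close>

lemma endpoint_in_J: "level_endpoint p n i \<in> J"
  by (induction n arbitrary: i) (auto simp: u_in v_in J_step simp del: power_Suc)

lemma endpoint_0: "level_endpoint p n 0 = 0"
  by (induction n) auto

lemma endpoint_last: "level_endpoint p n (2 * 2 ^ n - 1) = L"
proof (induction n)
  case (Suc n)
  have "2 * 2 ^ Suc n - 1 - 2 ^ Suc n = 2 * 2 ^ n - (1::nat)" by simp
  moreover have "\<not> 2 * 2 ^ Suc n - 1 < (2 ^ Suc n :: nat)" by simp
  ultimately have "level_endpoint p (Suc n) (2 * 2 ^ Suc n - 1) = (1 + L) / p"
    using Suc.IH by (simp only: level_endpoint.simps if_False)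
  also have "\<dots> = L" unfolding L_bounds(3)[symmetric] using p by simp
  finally show ?case .
qed simp

lemma endpoint_less: "Suc i < 2 * 2 ^ n \<Longrightarrow> level_endpoint p n i < level_endpoint p n (Suc i)"
proof (induction n arbitrary: i)
  case 0
  then show ?case using L_bounds by simp
next
  case (Suc n)
  consider "Suc i < 2 ^ Suc n" | "Suc i = 2 ^ Suc n" | "i \<ge> 2 ^ Suc n" by linarith
  then show ?case
  proof cases
    case 1
    then show ?thesis using Suc.IH[of i] p by (simp add: divide_strict_right_mono)
  next
    case 2
    have "level_endpoint p n i / p \<le> L / p"
      using J_in[OF endpoint_in_J] p by (intro divide_right_mono) auto
    also have "\<dots> < 1 / p" by (rule L_bounds)
    also have "\<dots> \<le> (1 + level_endpoint p n (Suc i - 2 ^ Suc n)) / p"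
      using J_in[OF endpoint_in_J] p by (intro divide_right_mono) auto
    finally show ?thesis using 2 by (simp del: power_Suc)
  next
    case 3
    then show ?thesis using Suc.IH[of "i - 2 ^ Suc n"] Suc.prems p
      by (simp add: divide_strict_right_mono Suc_diff_le)
  qed
qed

lemma endpoint_strict_mono:
  "i < j \<Longrightarrow> j < 2 * 2 ^ n \<Longrightarrow> level_endpoint p n i < level_endpoint p n j"
proof (induction j)
  case (Suc j)
  then show ?case using endpoint_less[of j n] by (cases "i = j") force+
qed simp

text \<open>Passing to the next level applies one of the two similarities, which divides lengths by
  \<open>p\<close> and increments of \<open>B\<close> by \<open>q\<close>.\<close>

lemma endpoint_interval:
  "k < 2 ^ n \<Longrightarrow> level_endpoint p n (Suc (2 * k)) - level_endpoint p n (2 * k) = L / p ^ n \<and>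
     B (level_endpoint p n (Suc (2 * k))) - B (level_endpoint p n (2 * k)) = M / q ^ n"
proof (induction n arbitrary: k)
  case 0
  then show ?case by (simp add: B_0 B_L)
next
  case (Suc n)
  show ?case
  proof (cases "k < 2 ^ n")
    case True
    then have "2 * k < 2 ^ Suc n" "Suc (2 * k) < 2 ^ Suc n" by simp_all
    then have "level_endpoint p (Suc n) (2 * k) = level_endpoint p n (2 * k) / p"
      "level_endpoint p (Suc n) (Suc (2 * k)) = level_endpoint p n (Suc (2 * k)) / p"
      by (simp_all del: power_Suc)
    then show ?thesis using Suc.IH[OF True]
      by (simp add: B_step_J endpoint_in_J flip: diff_divide_distrib)
  next
    case False
    define k' where "k' = k - 2 ^ n"
    have k': "k = 2 ^ n + k'" "k' < 2 ^ n" using False Suc.prems by (auto simp: k'_def)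
    have "\<not> 2 * k < 2 ^ Suc n" "\<not> Suc (2 * k) < 2 ^ Suc n"
      "2 * k - 2 ^ Suc n = 2 * k'" "Suc (2 * k) - 2 ^ Suc n = Suc (2 * k')" using k' by simp_all
    then have "level_endpoint p (Suc n) (2 * k) = (1 + level_endpoint p n (2 * k')) / p"
      "level_endpoint p (Suc n) (Suc (2 * k)) = (1 + level_endpoint p n (Suc (2 * k'))) / p"
      by (simp_all del: power_Suc)
    then show ?thesis using Suc.IH[OF k'(2)]
      by (simp add: B_step_J endpoint_in_J flip: diff_divide_distrib)
  qed
qed

lemma chain_in_endpoints: "chain_in {0..L} (2 * 2 ^ n - 1) (level_endpoint p n)"
  unfolding chain_in_def using endpoint_in_J J_sub endpoint_less by (auto simp: subset_iff)

text \<open>The intervals of level \<open>n\<close> alone contribute \<open>(2 / q) ^ n * M\<close>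
  to the variation, which is unbounded in \<open>n\<close>.\<close>

lemma B_not_bounded_variation:
  assumes "q < 2"
  shows "\<not> bounded_variation_on {0..L} B"
proof
  assume "bounded_variation_on {0..L} B"
  then obtain K where K: "\<And>n t. chain_in {0..L} n t \<Longrightarrow> (\<Sum>i<n. \<bar>B (t (Suc i)) - B (t i)\<bar>) \<le> K"
    unfolding bounded_variation_on_def by blast
  have "1 < 2 / q" using assms q by simp
  then obtain n where n: "K / M < (2 / q) ^ n" using real_arch_pow by blast
  let ?t = "level_endpoint p n"
  have "(2 / q) ^ n * M = (\<Sum>k<2 ^ n::nat. M / q ^ n)" by (simp add: power_divide)
  also have "\<dots> = (\<Sum>k<2 ^ n. \<bar>B (?t (Suc (2 * k))) - B (?t (2 * k))\<bar>)"
    using endpoint_interval q by (intro sum.cong) auto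
  also have "\<dots> \<le> (\<Sum>i<2 * 2 ^ n - 1. \<bar>B (?t (Suc i)) - B (?t i)\<bar>)"
    by (rule sum_even_le) simp
  also have "\<dots> \<le> K" by (rule K[OF chain_in_endpoints])
  finally show False using n M_bounds(1) by (simp only: pos_divide_less_eq)
qed

section \<open>Monotonicity, and the borderline case \<open>q = 2\<close>\<close>

lemma B_mono: "q \<ge> 2 \<Longrightarrow> mono_on {0..L} B"
  by (rule mono_on_hull[OF gap_affine_B], rule mono_onI)
    (use base_change_mono(1)[OF p] B_on_J in \<open>force simp: le_less\<close>)

lemma B_strict_mono: "q > 2 \<Longrightarrow> strict_mono_on {0..L} B"
  by (rule strict_mono_on_hull[OF gap_affine_B], rule strict_mono_onI)
    (use base_change_mono(2)[OF p] B_on_J in force)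

lemma power_2_over_p: "(\<lambda>n. L * (2 / p) ^ n) \<longlonglongrightarrow> 0"
  using p by (intro tendsto_mult_right_zero LIMSEQ_realpow_zero) auto

text \<open>The intervals of level \<open>n\<close> have total length
  \<open>L * (2 / p) ^ n\<close>, which tends to 0, yet they carry the full increment 1 of
  \<open>B\<close>.\<close>

lemma B_not_abs_continuous:
  assumes "q = 2"
  shows "\<not> abs_continuous_on {0..L} B"
proof
  assume "abs_continuous_on {0..L} B"
  \<comment> \<open>The choice \<open>\<epsilon> = 1\<close> suffices, because the definition asks
    for a strict inequality and the total increment equals 1.\<close>
  then have "\<exists>\<delta>>0. \<forall>(n::nat) u v. (\<forall>i<n. u i \<le> v i \<and> {u i..v i} \<subseteq> {0..L}) \<longrightarrow>
        disjoint_family_on (\<lambda>i. {u i<..<v i}) {..<n} \<longrightarrow> (\<Sum>i<n. v i - u i) < \<delta> \<longrightarrow>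
        (\<Sum>i<n. \<bar>B (v i) - B (u i)\<bar>) < 1"
    unfolding abs_continuous_on_def by (elim allE[of _ 1] impE) simp_all
  then obtain \<delta> where "0 < \<delta>" and \<delta>: "\<And>(n::nat) u v. (\<forall>i<n. u i \<le> v i \<and> {u i..v i} \<subseteq> {0..L}) \<Longrightarrow>
        disjoint_family_on (\<lambda>i. {u i<..<v i}) {..<n} \<Longrightarrow> (\<Sum>i<n. v i - u i) < \<delta> \<Longrightarrow>
        (\<Sum>i<n. \<bar>B (v i) - B (u i)\<bar>) < 1"
    by (elim exE conjE) (rule that; blast)
  obtain n where n: "L * (2 / p) ^ n < \<delta>"
    using order_tendstoD(2)[OF power_2_over_p \<open>0 < \<delta>\<close>] by (auto simp: eventually_sequentially)
  let ?t = "level_endpoint p n"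
  have "(\<Sum>k<2 ^ n. \<bar>B (?t (Suc (2 * k))) - B (?t (2 * k))\<bar>) < 1"
  proof (rule \<delta>)
    show "\<forall>k<2 ^ n. ?t (2 * k) \<le> ?t (Suc (2 * k)) \<and> {?t (2 * k)..?t (Suc (2 * k))} \<subseteq> {0..L}"
      using J_in[OF endpoint_in_J] endpoint_less by (auto intro!: less_imp_le intro: order_trans)
    show "disjoint_family_on (\<lambda>k. {?t (2 * k)<..<?t (Suc (2 * k))}) {..<2 ^ n}"
      unfolding disjoint_family_on_def
    proof (intro ballI impI)
      have *: "{?t (2 * i)<..<?t (Suc (2 * i))} \<inter> {?t (2 * j)<..<?t (Suc (2 * j))} = {}"
        if "i < j" "j < 2 ^ n" for i j
        using endpoint_strict_mono[of "Suc (2 * i)" "2 * j" n] that by force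
      fix i j assume "i \<in> {..<2 ^ n}" "j \<in> {..<2 ^ n}" "(i::nat) \<noteq> j"
      then show "{?t (2 * i)<..<?t (Suc (2 * i))} \<inter> {?t (2 * j)<..<?t (Suc (2 * j))} = {}"
        using *[of i j] *[of j i] by (cases "i < j") (auto simp: Int_commute)
    qed
    have "(\<Sum>k<2 ^ n. ?t (Suc (2 * k)) - ?t (2 * k)) = (\<Sum>k<2 ^ n::nat. L / p ^ n)"
      using endpoint_interval by (intro sum.cong) auto
    also have "\<dots> < \<delta>" using n by (simp add: power_divide)
    finally show "(\<Sum>k<2 ^ n. ?t (Suc (2 * k)) - ?t (2 * k)) < \<delta>" .
  qed
  moreover have "(\<Sum>k<2 ^ n. \<bar>B (?t (Suc (2 * k))) - B (?t (2 * k))\<bar>) = (\<Sum>k<2 ^ n::nat. 1 / 2 ^ n)"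
    using endpoint_interval assms by (intro sum.cong) auto
  ultimately show False by simp
qed

text \<open>For a nondecreasing function each chord is at most its horizontal plus its vertical
  part, so the length is at most \<open>L + 1\<close>. The chains of level endpoints approach this
  bound: they are asymptotically vertical on the intervals and cover almost all of the horizontal
  length on the gaps.\<close>

lemma B_arc_length:
  assumes "q = 2"
  shows "arc_length_on {0..L} B = ereal (p / (p - 1))"
proof (rule antisym)
  have total: "p / (p - 1) = L + 1" using p by (simp add: field_simps)
  show "arc_length_on {0..L} B \<le> ereal (p / (p - 1))"
    unfolding arc_length_on_def
  proof (rule SUP_least, clarify)
    fix n t assume t: "chain_in {0..L} n t"
    have mono: "B x \<le> B y" if "x \<in> {0..L}" "y \<in> {0..L}" "x \<le> y" for x y
      using B_mono assms that by (auto simp: mono_on_def)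
    have "dist (t i, B (t i)) (t (Suc i), B (t (Suc i))) \<le> (t (Suc i) - t i) + (B (t (Suc i)) - B (t i))"
      if "i < n" for i
    proof -
      have "t i < t (Suc i)" "B (t i) \<le> B (t (Suc i))"
        using t that mono[of "t i" "t (Suc i)"] by (auto simp: chain_in_def)
      then show ?thesis
        using sqrt_sum_squares_le_sum_abs[of "dist (t i) (t (Suc i))" "dist (B (t i)) (B (t (Suc i)))"]
        by (simp add: dist_Pair_Pair dist_real_def)
    qed
    then have "(\<Sum>i<n. dist (t i, B (t i)) (t (Suc i), B (t (Suc i))))
        \<le> (\<Sum>i<n. (t (Suc i) - t i) + (B (t (Suc i)) - B (t i)))" by (intro sum_mono) auto
    also have "\<dots> = (t n - t 0) + (B (t n) - B (t 0))"
      by (simp add: sum.distrib sum_lessThan_telescope sum_lessThan_telescope[where f = "\<lambda>i. B (t i)"])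
    also have "\<dots> \<le> L + 1"
    proof -
      have "t 0 \<in> {0..L}" "t n \<in> {0..L}" using t by (auto simp: chain_in_def)
      then have "B 0 \<le> B (t 0)" "B (t n) \<le> B L" "0 \<le> t 0" "t n \<le> L"
        using L_bounds(1) by (auto intro!: mono)
      then show ?thesis using B_0 B_L assms by simp
    qed
    finally show "ereal (\<Sum>i<n. dist (t i, B (t i)) (t (Suc i), B (t (Suc i)))) \<le> ereal (p / (p - 1))"
      using total by simp
  qed
  have "ereal (L + 1 - L * (2 / p) ^ n) \<le> arc_length_on {0..L} B" for n
  proof -
    let ?t = "level_endpoint p n"
    let ?N = "2 * 2 ^ n - 1 :: nat"
    define d where "d i = dist (?t i, B (?t i)) (?t (Suc i), B (?t (Suc i)))" for i
    have d: "\<bar>?t (Suc i) - ?t i\<bar> \<le> d i" "\<bar>B (?t (Suc i)) - B (?t i)\<bar> \<le> d i" for i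
      using dist_fst_le[of "(?t i, B (?t i))" "(?t (Suc i), B (?t (Suc i)))"]
        dist_snd_le[of "(?t i, B (?t i))" "(?t (Suc i), B (?t (Suc i)))"]
      by (auto simp: d_def dist_real_def abs_minus_commute)
    \<comment> \<open>The excess of a chord over its horizontal part is nonnegative everywhere, and
      on an interval of level \<open>n\<close> it is at least the vertical minus the horizontal
      increment. Hence only the even steps need to be kept.\<close>
    have "1 - L * (2 / p) ^ n = (\<Sum>k<2 ^ n::nat. 1 / 2 ^ n - L / p ^ n)"
      by (simp add: right_diff_distrib power_divide)
    also have "\<dots> \<le> (\<Sum>k<2 ^ n. d (2 * k) - (?t (Suc (2 * k)) - ?t (2 * k)))"
    proof (rule sum_mono)
      fix k assume "k \<in> {..<2 ^ n :: nat}"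
      then have "k < 2 ^ n" by simp
      from endpoint_interval[OF this]
      show "1 / 2 ^ n - L / p ^ n \<le> d (2 * k) - (?t (Suc (2 * k)) - ?t (2 * k))"
        using d(2)[of "2 * k"] assms by auto
    qed
    also have "\<dots> \<le> (\<Sum>i<?N. d i - (?t (Suc i) - ?t i))"
      by (rule sum_even_le[where g = "\<lambda>i. d i - (?t (Suc i) - ?t i)"]) (use d(1) in \<open>auto simp: abs_le_iff\<close>)
    also have "\<dots> = (\<Sum>i<?N. d i) - L"
      by (simp only: sum_subtractf[of d] sum_lessThan_telescope endpoint_0 endpoint_last diff_zero)
    finally have "ereal (L + 1 - L * (2 / p) ^ n) \<le> ereal (\<Sum>i<?N. d i)" by simp
    also have "\<dots> \<le> arc_length_on {0..L} B"
      unfolding arc_length_on_def d_def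
      by (rule SUP_upper2[of "(?N, ?t)"]) (use chain_in_endpoints in auto)
    finally show ?thesis .
  qed
  moreover have "(\<lambda>n. ereal (L + 1 - L * (2 / p) ^ n)) \<longlonglongrightarrow> ereal (L + 1 - 0)"
    by (intro tendsto_ereal tendsto_diff tendsto_const power_2_over_p)
  ultimately show "ereal (p / (p - 1)) \<le> arc_length_on {0..L} B"
    unfolding total by (intro tendsto_upperbound[where F = sequentially and f = "\<lambda>n. ereal (L + 1 - L * (2 / p) ^ n)"]) auto
qed

section \<open>Absolute continuity and positive derivative for \<open>q > 2\<close>\<close>

definition clamp_hull :: "real \<Rightarrow> real" where
  "clamp_hull y = max 0 (min L y)"

text \<open>\<open>B\<close> is specified only on the hull, so the arguments of the compositions
  below are first projected into it.\<close>

lemma clamp_hull_in: "clamp_hull y \<in> {0..L}"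
  using L_bounds(1) by (auto simp: clamp_hull_def)

lemma clamp_hull_mono: "x \<le> y \<Longrightarrow> clamp_hull x \<le> clamp_hull y"
  by (auto simp: clamp_hull_def)

lemma clamp_hull_lipschitz: "\<bar>clamp_hull x - clamp_hull y\<bar> \<le> \<bar>x - y\<bar>"
proof -
  have "\<bar>max 0 (min l x) - max 0 (min l y)\<bar> \<le> \<bar>x - y\<bar>" for l :: real
    by linarith
  then show ?thesis by (simp only: clamp_hull_def)
qed

lemma clamp_hull_simps:
  "y \<le> 0 \<Longrightarrow> clamp_hull y = 0" "y \<ge> L \<Longrightarrow> clamp_hull y = L" "y \<in> {0..L} \<Longrightarrow> clamp_hull y = y"
  using L_bounds(1) by (auto simp: clamp_hull_def)

text \<open>Clamping turns the three-branch self-similarity into a single sum of compositions, so that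
  monotonicity and Lipschitz bounds pass through it without case distinctions.\<close>

lemma B_functional_equation:
  assumes x: "x \<in> {0..L}"
  shows "B x = (B (clamp_hull (p * x)) + B (clamp_hull (p * x - 1))) / q
    + (B (1 / p) - B (L / p)) / (1 / p - L / p) * (max (L / p) (min (1 / p) x) - L / p)"
proof -
  have end_pts: "B (L / p) = M / q" "B (1 / p) = 1 / q"
    using B_step_J(1)[OF v_in] B_step_J(2)[OF u_in] B_0 B_L by auto
  consider "x \<le> L / p" | "L / p < x" "x < 1 / p" | "1 / p \<le> x" by linarith
  then show ?thesis
  proof cases
    case 1
    then have "p * x \<le> L" using iffD1[OF pos_le_divide_eq[of p x L]] p by (simp only: mult.commute[of p])
    then have px: "p * x \<in> {0..L}" using x p by auto
    then have "clamp_hull (p * x) = p * x" "clamp_hull (p * x - 1) = 0"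
      using L_bounds(2) by (auto intro!: clamp_hull_simps)
    moreover have "max (L / p) (min (1 / p) x) = L / p" using 1 L_bounds(4) by auto
    ultimately show ?thesis using B_step(1)[OF px] p B_0 by simp
  next
    case 2
    then have "L < p * x" "p * x < 1"
      using iffD1[OF pos_divide_less_eq[of p L x]] iffD1[OF pos_less_divide_eq[of p x 1]] p
      by (simp_all only: mult.commute[of p])
    then have "clamp_hull (p * x) = L" "clamp_hull (p * x - 1) = 0" by (auto intro!: clamp_hull_simps)
    moreover have "max (L / p) (min (1 / p) x) = x" using 2 by auto
    ultimately show ?thesis
      using gap_affineD[OF gap_affine_B gap_middle, of x] 2 end_pts B_0 B_L by simp
  next
    case 3
    then have "1 \<le> p * x" using p by (auto simp: pos_divide_le_eq mult.commute)
    moreover have "p * x \<le> p * L" using x p by (intro mult_left_mono) auto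
    ultimately have px: "p * x - 1 \<in> {0..L}" and "L \<le> p * x" using L_bounds(2,3) by auto
    then have "clamp_hull (p * x) = L" "clamp_hull (p * x - 1) = p * x - 1"
      by (auto intro!: clamp_hull_simps)
    moreover have "max (L / p) (min (1 / p) x) = 1 / p" using 3 L_bounds(4) by auto
    \<comment> \<open>The completed ramp adds \<open>B (1 / p) - B (L / p)\<close>, which replaces
      the contribution \<open>M / q\<close> of the first copy by \<open>1 / q\<close>.\<close>
    moreover have "1 / p - L / p \<noteq> 0" using L_bounds(4) by linarith
    ultimately show ?thesis
      using B_step(2)[OF px] p B_L end_pts by (simp add: add_divide_distrib)
  qed
qed

text \<open>Here \<open>h\<close> carries the increments of \<open>B\<close> inside the \<open>2 ^ n\<close> intervals of level \<open>n\<close>,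
  and \<open>B - h\<close> the increments on the gaps between them.\<close>

lemma B_decomposition:
  assumes q2: "q \<ge> 2"
  shows "\<exists>h K. mono_on {0..L} h \<and> h 0 = 0 \<and> h L = (2 / q) ^ n * M \<and> 0 \<le> K \<and>
    (\<forall>x\<in>{0..L}. \<forall>y\<in>{0..L}. \<bar>(B x - h x) - (B y - h y)\<bar> \<le> K * \<bar>x - y\<bar>)"
proof (induction n)
  case 0
  show ?case by (rule exI[of _ B], rule exI[of _ 0]) (use B_mono[OF q2] B_0 B_L in auto)
next
  case (Suc n)
  then obtain h K where h: "mono_on {0..L} h" "h 0 = 0" "h L = (2 / q) ^ n * M" "0 \<le> K" and
    K: "\<And>x y. x \<in> {0..L} \<Longrightarrow> y \<in> {0..L} \<Longrightarrow> \<bar>(B x - h x) - (B y - h y)\<bar> \<le> K * \<bar>x - y\<bar>"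
    by blast
  \<comment> \<open>The functional equation of \<open>B\<close> applied to \<open>h\<close> without
    its ramp term. The ramp over the central gap, of slope \<open>s\<close>, thereby joins the
    Lipschitz part.\<close>
  define h' where "h' x = (h (clamp_hull (p * x)) + h (clamp_hull (p * x - 1))) / q" for x
  define s where "s = (B (1 / p) - B (L / p)) / (1 / p - L / p)"
  define m where "m x = max (L / p) (min (1 / p) x)" for x
  define d where "d x = B x - h x" for x
  have d: "\<bar>d (clamp_hull x) - d (clamp_hull y)\<bar> \<le> K * \<bar>x - y\<bar>" for x y
  proof -
    have "\<bar>d (clamp_hull x) - d (clamp_hull y)\<bar> \<le> K * \<bar>clamp_hull x - clamp_hull y\<bar>"
      unfolding d_def by (intro K clamp_hull_in)
    also have "\<dots> \<le> K * \<bar>x - y\<bar>" using h(4) clamp_hull_lipschitz by (intro mult_left_mono) auto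
    finally show ?thesis .
  qed
  have mono: "mono_on {0..L} h'"
  proof (rule mono_onI)
    fix x y :: real assume "x \<le> y"
    then have "p * x \<le> p * y" using p by simp
    then show "h' x \<le> h' y"
      unfolding h'_def using h(1) q clamp_hull_in clamp_hull_mono
      by (intro divide_right_mono add_mono) (auto simp: mono_on_def)
  qed
  have h0: "h' 0 = 0" by (simp add: h'_def clamp_hull_simps h(2))
  \<comment> \<open>At \<open>L\<close> both clamped arguments equal \<open>L\<close>, so the total
    increment of \<open>h\<close> is multiplied by \<open>2 / q\<close>.\<close>
  have "p * L \<ge> L" "p * L - 1 \<ge> L" using L_bounds by auto
  then have hL: "h' L = (2 / q) ^ Suc n * M" by (simp add: h'_def clamp_hull_simps(2) h(3) field_simps)
  have "\<bar>(B x - h' x) - (B y - h' y)\<bar> \<le> (2 * K * p / q + \<bar>s\<bar>) * \<bar>x - y\<bar>"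
    if "x \<in> {0..L}" "y \<in> {0..L}" for x y
  proof -
    have eq: "B z - h' z = (d (clamp_hull (p * z)) + d (clamp_hull (p * z - 1))) / q + s * (m z - L / p)"
      if "z \<in> {0..L}" for z
      using B_functional_equation[OF that]
      by (simp add: h'_def d_def s_def m_def add_divide_distrib diff_divide_distrib)
    have "\<bar>(B x - h' x) - (B y - h' y)\<bar>
        = \<bar>((d (clamp_hull (p * x)) - d (clamp_hull (p * y)))
           + (d (clamp_hull (p * x - 1)) - d (clamp_hull (p * y - 1)))) / q + s * (m x - m y)\<bar>"
      unfolding eq[OF that(1)] eq[OF that(2)]
      by (simp add: algebra_simps add_divide_distrib diff_divide_distrib)
    also have "\<dots> \<le> (\<bar>d (clamp_hull (p * x)) - d (clamp_hull (p * y))\<bar>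
           + \<bar>d (clamp_hull (p * x - 1)) - d (clamp_hull (p * y - 1))\<bar>) / q + \<bar>s\<bar> * \<bar>m x - m y\<bar>"
      using q by (intro order_trans[OF abs_triangle_ineq] add_mono)
        (auto simp: abs_mult intro!: divide_right_mono)
    also have "\<dots> \<le> (K * \<bar>p * x - p * y\<bar> + K * \<bar>(p * x - 1) - (p * y - 1)\<bar>) / q + \<bar>s\<bar> * \<bar>x - y\<bar>"
      using q by (intro add_mono divide_right_mono mult_left_mono d) (auto simp: m_def)
    also have "\<bar>p * x - p * y\<bar> = p * \<bar>x - y\<bar>"
      using p by (simp add: abs_mult flip: right_diff_distrib)
    also have "(p * x - 1) - (p * y - 1) = p * x - p * y" by simp
    also have "\<bar>p * x - p * y\<bar> = p * \<bar>x - y\<bar>"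
      using p by (simp add: abs_mult flip: right_diff_distrib)
    finally show ?thesis by (simp add: algebra_simps add_divide_distrib)
  qed
  moreover have "0 \<le> 2 * K * p / q + \<bar>s\<bar>" using h(4) p q by simp
  ultimately show ?case using mono h0 hL by blast
qed

text \<open>A deep level makes the total increment of \<open>h\<close> less than
  \<open>\<epsilon> / 2\<close>, however the intervals are placed; the remainder
  \<open>B - h\<close> is Lipschitz and is controlled by the total length.\<close>

lemma B_abs_continuous:
  assumes "q > 2"
  shows "abs_continuous_on {0..L} B"
  unfolding abs_continuous_on_def
proof (intro allI impI)
  fix \<epsilon> :: real assume \<epsilon>: "0 < \<epsilon>"
  have "(\<lambda>n. (2 / q) ^ n * M) \<longlonglongrightarrow> 0"
    using assms by (intro tendsto_mult_left_zero LIMSEQ_realpow_zero) auto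
  then have "\<forall>\<^sub>F n in sequentially. (2 / q) ^ n * M < \<epsilon> / 2"
    by (rule order_tendstoD) (use \<epsilon> in simp)
  then obtain n where n: "(2 / q) ^ n * M < \<epsilon> / 2"
    using eventually_happens'[OF sequentially_bot] by blast
  obtain h K where h: "mono_on {0..L} h" "h 0 = 0" "h L = (2 / q) ^ n * M" "0 \<le> K" and
    K: "\<And>x y. x \<in> {0..L} \<Longrightarrow> y \<in> {0..L} \<Longrightarrow> \<bar>(B x - h x) - (B y - h y)\<bar> \<le> K * \<bar>x - y\<bar>"
    using B_decomposition[of n] assms by force
  \<comment> \<open>\<open>K + 1\<close> rather than \<open>K\<close>, since \<open>K\<close> may be
    0.\<close>
  define \<delta> where "\<delta> = \<epsilon> / (2 * (K + 1))"
  have \<delta>: "0 < \<delta>" "K * \<delta> \<le> \<epsilon> / 2" using \<epsilon> h(4) by (auto simp: \<delta>_def field_simps)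
  have "(\<Sum>i<N. \<bar>B (v i) - B (u i)\<bar>) < \<epsilon>"
    if uv: "\<forall>i<N. u i \<le> v i \<and> {u i..v i} \<subseteq> {0..L}"
      and disj: "disjoint_family_on (\<lambda>i. {u i<..<v i}) {..<N}" and len: "(\<Sum>i<N. v i - u i) < \<delta>"
    for N :: nat and u v
  proof -
    have "\<bar>B (v i) - B (u i)\<bar> \<le> K * (v i - u i) + (h (v i) - h (u i))" if "i < N" for i
    proof -
      have i: "u i \<in> {0..L}" "v i \<in> {0..L}" "u i \<le> v i" using uv that by auto
      then have "h (u i) \<le> h (v i)" using h(1) by (auto simp: mono_on_def)
      then show ?thesis using K[OF i(2,1)] i(3) by linarith
    qed
    then have "(\<Sum>i<N. \<bar>B (v i) - B (u i)\<bar>) \<le> (\<Sum>i<N. K * (v i - u i) + (h (v i) - h (u i)))"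
      by (intro sum_mono) auto
    also have "\<dots> = K * (\<Sum>i<N. v i - u i) + (\<Sum>i<N. h (v i) - h (u i))"
      by (simp add: sum.distrib sum_distrib_left)
    also have "\<dots> \<le> K * \<delta> + (h L - h 0)"
      using uv disj len h(1,4) L_bounds(1)
      by (intro add_mono mult_left_mono sum_mono_increments_le) auto
    also have "\<dots> < \<epsilon>" using \<delta>(2) n unfolding h(2,3) by linarith
    finally show ?thesis .
  qed
  then show "\<exists>\<delta>>0. \<forall>(n::nat) u v. (\<forall>i<n. u i \<le> v i \<and> {u i..v i} \<subseteq> {0..L}) \<longrightarrow>
      disjoint_family_on (\<lambda>i. {u i<..<v i}) {..<n} \<longrightarrow> (\<Sum>i<n. v i - u i) < \<delta> \<longrightarrow>
      (\<Sum>i<n. \<bar>B (v i) - B (u i)\<bar>) < \<epsilon>"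
    using \<delta>(1) by blast
qed

text \<open>Off the null set \<open>J\<close> the derivative is the chord slope of a gap, which is
  positive by strict monotonicity.\<close>

lemma B_AE_positive_derivative:
  assumes "q > 2"
  shows "AE x\<in>{0..L} in lebesgue. \<exists>D>0. (B has_real_derivative D) (at x within {0..L})"
  using AE_not_in_J
proof eventually_elim
  case (elim x)
  show ?case
  proof
    assume "x \<in> {0..L}"
    then obtain a b where g: "gap J a b" and D: "(B has_real_derivative (B b - B a) / (b - a)) (at x)"
      using gap_affine_has_derivative[OF gap_affine_B _ elim] by blast
    have "a < b" "a \<in> {0..L}" "b \<in> {0..L}" using g J_in[of a] J_in[of b] by (auto simp: gap_def)
    then have "0 < (B b - B a) / (b - a)"
      using B_strict_mono[OF assms] by (simp add: strict_mono_on_def)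
    then show "\<exists>D>0. (B has_real_derivative D) (at x within {0..L})"
      using has_field_derivative_at_within[OF D] by blast
  qed
qed

end

theorem theorem1p6:
  fixes p q :: real
  assumes "p > 2" and "q > 1"
  defines "I \<equiv> {0..1 / (p - 1)}"
    and "B \<equiv> base_change_ext p q"
  shows "((AE x\<in>I in lebesgue. B differentiable (at x within I)) \<and>
          exact_holder_on I (min 1 (ln q / ln p)) B) \<and>
         (q < 2 \<longrightarrow> \<not> bounded_variation_on I B) \<and>
         (q = 2 \<longrightarrow>
            mono_on I B \<and> \<not> abs_continuous_on I B \<and>
            arc_length_on I B = ereal (p / (p - 1))) \<and>
         (q > 2 \<longrightarrow>
            strict_mono_on I B \<and> abs_continuous_on I B \<and>
            (AE x\<in>I in lebesgue. \<exists>D>0. (B has_real_derivative D) (at x within I)))"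
proof -
  interpret base_change_pair p q by unfold_locales (use assms in auto)
  show ?thesis
    unfolding I_def B_def exact_holder_on_def
    using B_AE_differentiable B_holder B_not_holder B_not_bounded_variation B_mono
      B_not_abs_continuous B_arc_length B_strict_mono B_abs_continuous B_AE_positive_derivative
    by auto
qed

end
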